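(* Let $q$ be an odd prime power, $\varepsilon_q=1$ if $q\equiv1\pmod 4$ and $\varepsilon_q=-1$ if $q\equiv 3\pmod 4$. Let $N_0=(\mathbb{F}_q^2,+)$, $H_0=SO_2(\mathbb{F}_q)=\left\{\begin{pmatrix}a&-b\\ b&a\end{pmatrix}: a,b\in\mathbb{F}_q,\ a^2+b^2=1\right\}$, and $G_0=N_0\rtimes H_0$ with multiplication $(z_1,h_1)(z_2,h_2)=(z_1+h_1z_2,h_1h_2)$. Then $G_0$ has exactly $q-\varepsilon_q$ irreducible complex representations of type I, all of degree $1$, and exactly $q+\varepsilon_q$ irreducible complex representations of type II, all of degree $q-\varepsilon_q$. In particular $G_0$ is $(q-\varepsilon_q)$-quasirandom on $N_0$.
   Context: A complex representation $\rho$ of $G_0$ is of type I if $\rho((z,1))$ is the identity for all $z\in N_0$ (equivalently, it is lifted from a representation of $H_0\cong G_0/\{(z,1)\}$), and of type II otherwise. $G_0$ is $D$-quasirandom on $N_0$ if every type II representation has degree at least $D$. *)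

theory Defs
  imports
    "Jordan_Normal_Form.VS_Connect"
    "HOL-Library.Cardinality"
begin

section \<open>Complex matrix representations\<close>

definition GL :: "nat \<Rightarrow> complex mat monoid" where
  "GL n = units_of (ring_mat TYPE(complex) n ())"

text \<open>A representation of degree \<open>n\<close> is a homomorphism to \<open>GL n\<close>; the values of
  \<open>\<rho>\<close> outside \<open>carrier G\<close> are irrelevant.\<close>

definition representation :: "('g, 'b) monoid_scheme \<Rightarrow> nat \<Rightarrow> ('g \<Rightarrow> complex mat) \<Rightarrow> bool" where
  "representation G n \<rho> \<longleftrightarrow> \<rho> \<in> hom G (GL n)"

definition irreducible_rep :: "('g, 'b) monoid_scheme \<Rightarrow> nat \<Rightarrow> ('g \<Rightarrow> complex mat) \<Rightarrow> bool" where
  "irreducible_rep G n \<rho> \<longleftrightarrow>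
     representation G n \<rho> \<and> n \<noteq> 0 \<and>
     (\<forall>W. VectorSpace.subspace class_ring W (module_vec TYPE(complex) n) \<longrightarrow>
        (\<forall>g \<in> carrier G. \<forall>w \<in> W. \<rho> g *\<^sub>v w \<in> W) \<longrightarrow>
        W = {0\<^sub>v n} \<or> W = carrier_vec n)"

text \<open>Isomorphism of representations, each given as a pair of its degree and its underlying map.\<close>

definition rep_iso ::
  "('g, 'b) monoid_scheme \<Rightarrow> ((nat \<times> ('g \<Rightarrow> complex mat)) \<times> (nat \<times> ('g \<Rightarrow> complex mat))) set" where
  "rep_iso G = {((n, \<rho>), (m, \<sigma>)). representation G n \<rho> \<and> representation G m \<sigma> \<and> n = m \<and>
     (\<exists>P \<in> carrier (GL n). \<forall>g \<in> carrier G. P * \<rho> g = \<sigma> g * P)}"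

section \<open>The group\<close>

definition N0 :: "'a::field vec set" where
  "N0 = carrier_vec 2"

definition H0 :: "'a::field mat set" where
  "H0 = {mat_of_rows_list 2 [[a, - b], [b, a]] | a b. a\<^sup>2 + b\<^sup>2 = 1}"

definition G0 :: "('a::field vec \<times> 'a mat) monoid" where
  "G0 = \<lparr>carrier = N0 \<times> H0,
         mult = (\<lambda>(z1, h1) (z2, h2). (z1 + h1 *\<^sub>v z2, h1 * h2)),
         one = (0\<^sub>v 2, 1\<^sub>m 2)\<rparr>"

lemma H0_mult: "mat_of_rows_list 2 [[a, - b], [b, a]] * mat_of_rows_list 2 [[c, - d], [d, c]]
   = mat_of_rows_list 2 [[a*c-b*d, - (a*d+b*c)], [a*d+b*c, a*c-b*d::'a::field]]"
  by (rule eq_matI) (auto simp: mat_of_rows_list_def scalar_prod_def less_Suc_eq numeral_2_eq_2 algebra_simps)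

lemma H0_one: "1\<^sub>m 2 = mat_of_rows_list 2 [[1, - 0], [0, 1::'a::field]]"
  by (rule eq_matI) (auto simp: mat_of_rows_list_def less_Suc_eq numeral_2_eq_2)

lemma H0_carrier: "h \<in> H0 \<Longrightarrow> h \<in> carrier_mat 2 2"
  by (auto simp: H0_def mat_of_rows_list_def)

lemma H0_mult_closed: "g \<in> H0 \<Longrightarrow> h \<in> H0 \<Longrightarrow> g * h \<in> (H0::'a::field mat set)"
proof -
  assume "g \<in> H0" "h \<in> H0"
  then obtain a b c d where *: "g = mat_of_rows_list 2 [[a, - b], [b, a]]" "a\<^sup>2 + b\<^sup>2 = 1"
    "h = mat_of_rows_list 2 [[c, - d], [d, c]]" "c\<^sup>2 + d\<^sup>2 = 1" by (auto simp: H0_def)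
  have "(a*c-b*d)\<^sup>2 + (a*d+b*c)\<^sup>2 = (a\<^sup>2 + b\<^sup>2) * (c\<^sup>2 + d\<^sup>2)"
    by (simp add: power2_eq_square algebra_simps)
  then show ?thesis unfolding *(1,3) H0_mult using *(2,4) unfolding H0_def
    by (intro CollectI exI[of _ "a*c-b*d"] exI[of _ "a*d+b*c"]) simp
qed

lemma H0_inv: "g \<in> H0 \<Longrightarrow> \<exists>h \<in> H0. h * g = (1\<^sub>m 2 ::'a::field mat)"
proof -
  assume "g \<in> H0"
  then obtain a b where *: "g = mat_of_rows_list 2 [[a, - b], [b, a]]" "a\<^sup>2 + b\<^sup>2 = 1" by (auto simp: H0_def)
  let ?h = "mat_of_rows_list 2 [[a, - (-b)], [-b, a]]"
  have "?h \<in> H0" using *(2) unfolding H0_def by (intro CollectI exI[of _ a] exI[of _ "-b"]) simp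
  moreover have "?h * g = 1\<^sub>m 2" unfolding *(1) H0_mult H0_one using *(2) by (simp add: power2_eq_square algebra_simps)
  ultimately show ?thesis by blast
qed

lemma group_G0: "group (G0 :: ('a::field vec \<times> 'a mat) monoid)"
proof (rule groupI, goal_cases)
  case (1 x y) then show ?case by (auto simp: G0_def N0_def H0_mult_closed dest: H0_carrier)
next
  case 2 have "1\<^sub>m 2 \<in> H0" unfolding H0_def H0_one by (intro CollectI exI[of _ 1] exI[of _ 0]) simp
  then show ?case by (simp add: G0_def N0_def)
next
  case (3 x y z) then show ?case
    apply (auto simp: G0_def N0_def dest!: H0_carrier)
    apply (subst mult_add_distrib_mat_vec[of _ 2 2]) apply auto
    done
next
  case (4 x) then show ?case by (auto simp: G0_def N0_def dest!: H0_carrier)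
next
  case (5 x)
  obtain z g where x: "x = (z,g)" "z \<in> carrier_vec 2" "g \<in> H0" using 5 by (auto simp: G0_def N0_def)
  obtain h where h: "h \<in> H0" "h * g = 1\<^sub>m 2" using H0_inv[OF x(3)] by blast
  have "h *\<^sub>v z \<in> carrier_vec 2" using H0_carrier[OF h(1)] x(2) by simp
  then show ?case using x h by (intro bexI[of _ "(- (h *\<^sub>v z), h)"]) (auto simp: G0_def N0_def)
qed

section \<open>Types of representations and quasirandomness\<close>

definition type_I :: "nat \<Rightarrow> ('a::field vec \<times> 'a mat \<Rightarrow> complex mat) \<Rightarrow> bool" where
  "type_I n \<rho> \<longleftrightarrow> representation G0 n \<rho> \<and> (\<forall>z \<in> N0. \<rho> (z, 1\<^sub>m 2) = 1\<^sub>m n)"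

definition type_II :: "nat \<Rightarrow> ('a::field vec \<times> 'a mat \<Rightarrow> complex mat) \<Rightarrow> bool" where
  "type_II n \<rho> \<longleftrightarrow> representation G0 n \<rho> \<and> \<not> type_I n \<rho>"

definition quasirandom_on_N0 :: "'a::field itself \<Rightarrow> real \<Rightarrow> bool" where
  "quasirandom_on_N0 _ D \<longleftrightarrow>
     (\<forall>n (\<rho> :: 'a vec \<times> 'a mat \<Rightarrow> complex mat). type_II n \<rho> \<longrightarrow> D \<le> real n)"

definition irr_type_I :: "(nat \<times> ('a::field vec \<times> 'a mat \<Rightarrow> complex mat)) set" where
  "irr_type_I = {(n, \<rho>). irreducible_rep G0 n \<rho> \<and> type_I n \<rho>}"

definition irr_type_II :: "(nat \<times> ('a::field vec \<times> 'a mat \<Rightarrow> complex mat)) set" where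
  "irr_type_II = {(n, \<rho>). irreducible_rep G0 n \<rho> \<and> type_II n \<rho>}"

text \<open>The sign \<open>\<epsilon>\<^sub>q\<close>, meaningful for odd \<open>q\<close> only.\<close>

definition eps :: "nat \<Rightarrow> int" where
  "eps q = (if q mod 4 = 1 then 1 else - 1)"

end

theory Submission
  imports Defs "HOL-Algebra.Multiplicative_Group"
begin

text \<open>Decompose the restriction of a representation of \<open>G\<^sub>0\<close> to the abelian group \<open>N\<^sub>0\<close> into
  weight spaces indexed by the characters of \<open>N\<^sub>0\<close>; \<open>H\<^sub>0\<close> permutes these spaces along with the
  characters. Since \<open>h - 1\<close> is invertible on \<open>N\<^sub>0\<close> for every \<open>h \<noteq> 1\<close> in \<open>H\<^sub>0\<close>, the action of \<open>H\<^sub>0\<close>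
  on the \<open>q\<^sup>2 - 1\<close> nontrivial characters is free. A type II representation has a nonzero vector of
  some nontrivial weight, and its \<open>|H\<^sub>0|\<close> translates have distinct weights, so they are linearly
  independent; in the irreducible case they form a basis, in which the representation is the one
  induced from that character of \<open>N\<^sub>0\<close>. Hence the type II irreducibles correspond to the orbits of
  \<open>H\<^sub>0\<close> on nontrivial characters, and the type I irreducibles to the characters of the abelian group
  \<open>H\<^sub>0\<close>. Finally \<open>|H\<^sub>0| = q - \<epsilon>\<^sub>q\<close> by stereographic projection of the circle \<open>a\<^sup>2 + b\<^sup>2 = 1\<close>.\<close>

text \<open>The type II irreducibles are classified without traces or a sum-of-squares count. The
  nontrivial weights of a representation form an isomorphism invariant; for a type II irreducible
  they are one full orbit, and any weight in it rebuilds the representation, so equal weight sets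
  force isomorphism. Two properties of finite abelian groups carry this. Dual orthogonality, which
  needs enough characters to separate points, makes the weight components of a vector add up to it,
  so a representation without nontrivial weights is trivial on \<open>N0\<close>. Orthogonality
  makes distinct characters independent, hence also the translates of a weight vector. Oddness of
  \<open>q\<close> enters through \<open>det (h - 1) = 2 * (1 - a)\<close> for \<open>h\<close> with
  entries \<open>a\<close>, \<open>b\<close>: if 2 is nonzero, this vanishes only for
  \<open>a = 1\<close>, and then \<open>b = 0\<close>. The number of orbits is
  \<open>q + eps q\<close> because \<open>eps q\<close> squares to 1. Quasirandomness also concerns
  reducible representations, so its bound is taken from the independence of the translates and not
  from the classification.\<close>

section \<open>Characters of finite abelian groups\<close>

text \<open>Values off the carrier are pinned to \<open>undefined\<close>, so that equality of
  characters is equality of functions and \<open>card (chars G)\<close> is meaningful; the value at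
  the identity excludes the zero function.\<close>

definition chars :: "('g, 'b) monoid_scheme \<Rightarrow> ('g \<Rightarrow> complex) set" where
  "chars G = {\<chi> \<in> carrier G \<rightarrow>\<^sub>E UNIV. \<chi> \<one>\<^bsub>G\<^esub> = 1 \<and>
     (\<forall>x\<in>carrier G. \<forall>y\<in>carrier G. \<chi> (x \<otimes>\<^bsub>G\<^esub> y) = \<chi> x * \<chi> y)}"

lemma chars_one: "\<chi> \<in> chars G \<Longrightarrow> \<chi> \<one>\<^bsub>G\<^esub> = 1"
  and chars_mult: "\<chi> \<in> chars G \<Longrightarrow> x \<in> carrier G \<Longrightarrow> y \<in> carrier G \<Longrightarrow> \<chi> (x \<otimes>\<^bsub>G\<^esub> y) = \<chi> x * \<chi> y"
  and chars_undefined: "\<chi> \<in> chars G \<Longrightarrow> x \<notin> carrier G \<Longrightarrow> \<chi> x = undefined"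
  by (auto simp: chars_def)

lemma chars_eqI:
  "\<chi> \<in> chars G \<Longrightarrow> \<chi>' \<in> chars G \<Longrightarrow> (\<And>x. x \<in> carrier G \<Longrightarrow> \<chi> x = \<chi>' x) \<Longrightarrow> \<chi> = \<chi>'"
  by (auto simp: chars_def intro: PiE_ext)

lemma charsI:
  assumes "\<chi> \<one>\<^bsub>G\<^esub> = 1" "monoid G"
    and "\<And>x y. x \<in> carrier G \<Longrightarrow> y \<in> carrier G \<Longrightarrow> \<chi> (x \<otimes>\<^bsub>G\<^esub> y) = \<chi> x * \<chi> y"
  shows "restrict \<chi> (carrier G) \<in> chars G"
  using assms monoid.one_closed[OF assms(2)] monoid.m_closed[OF assms(2)] by (auto simp: chars_def)

section \<open>Extending characters of subgroups and separating points\<close>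

lemma complex_root_exists:
  assumes "k > 0"
  shows "\<exists>c::complex. c ^ k = w"
proof -
  have "w = rcis (cmod w) (Arg w)" by (simp add: rcis_cmod_Arg)
  moreover have "rcis (root k (cmod w)) (Arg w / k) ^ k = rcis (cmod w) (Arg w)"
    using assms by (simp add: DeMoivre2 real_root_pow_pos2)
  ultimately show ?thesis by metis
qed

lemma nontrivial_root_of_unity:
  assumes "k > (1::nat)"
  shows "\<exists>c::complex. c ^ k = 1 \<and> c \<noteq> 1"
proof (rule ccontr)
  assume "\<not> ?thesis"
  then have "{z::complex. z ^ k = 1} \<subseteq> {1}" by auto
  then have "card {z::complex. z ^ k = 1} \<le> 1" by (metis card_mono finite.simps is_singletonI is_singleton_altdef)
  then show False using assms card_roots_unity_eq[of k] by simp
qed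

text \<open>Nothing is required off \<open>K\<close>, so an extension to a larger subgroup is just
  another function that agrees on \<open>K\<close>.\<close>

definition partial_char :: "('g, 'b) monoid_scheme \<Rightarrow> 'g set \<Rightarrow> ('g \<Rightarrow> complex) \<Rightarrow> bool" where
  "partial_char G K \<chi> \<longleftrightarrow> subgroup K G \<and> \<chi> \<one>\<^bsub>G\<^esub> = 1 \<and>
     (\<forall>x\<in>K. \<forall>y\<in>K. \<chi> (x \<otimes>\<^bsub>G\<^esub> y) = \<chi> x * \<chi> y)"

lemma (in monoid) partial_char_pow:
  "partial_char G K \<chi> \<Longrightarrow> x \<in> K \<Longrightarrow> \<chi> (x [^] (t::nat)) = \<chi> x ^ t \<and> x [^] t \<in> K"
  by (induction t) (auto simp: partial_char_def intro: subgroup.m_closed subgroup.one_closed)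

text \<open>The extension sends \<open>h \<otimes> g [^] j\<close> to
  \<open>\<chi> h * c ^ j\<close>. Two expressions for one element differ by a power of
  \<open>g\<close> in \<open>K\<close>, whose exponent is a multiple of \<open>k\<close>, and there
  \<open>c ^ k = \<chi> (g [^] k)\<close> makes the values agree. Every such root \<open>c\<close>
  is admissible, and this freedom is what later separates points.\<close>

lemma (in comm_group) partial_char_adjoin:
  assumes K: "partial_char G K \<chi>" and g: "g \<in> carrier G" and k: "k > 0" "g [^] k \<in> K"
    and dvd: "\<And>j. g [^] j \<in> K \<Longrightarrow> k dvd j" and c: "c ^ k = \<chi> (g [^] (k::nat))"
  shows "\<exists>K' \<chi>'. partial_char G K' \<chi>' \<and> K \<subseteq> K' \<and> g \<in> K' \<and> (\<forall>x\<in>K. \<chi>' x = \<chi> x) \<and> \<chi>' g = c"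
proof -
  have sub: "subgroup K G" and mult: "\<And>x y. x \<in> K \<Longrightarrow> y \<in> K \<Longrightarrow> \<chi> (x \<otimes> y) = \<chi> x * \<chi> y"
    and one: "\<chi> \<one> = 1" using K by (auto simp: partial_char_def)
  have KG: "x \<in> carrier G" if "x \<in> K" for x using that sub by (meson subgroup.mem_carrier)
  define K' where "K' = {h \<otimes> g [^] j | h (j::nat). h \<in> K}"
  define \<chi>' where "\<chi>' x = (SOME y. \<exists>h j. h \<in> K \<and> x = h \<otimes> g [^] (j::nat) \<and> y = \<chi> h * c ^ j)" for x
  have wd_le: "\<chi> h * c ^ i = \<chi> h' * c ^ j"
    if h: "h \<in> K" "h' \<in> K" "h \<otimes> g [^] i = h' \<otimes> g [^] j" and le: "i \<le> j" for h h' and i j :: nat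
  proof -
    have "h \<otimes> g [^] i = h' \<otimes> g [^] (j - i) \<otimes> g [^] i"
      using h KG g le by (simp add: m_assoc nat_pow_mult)
    then have eq: "h = h' \<otimes> g [^] (j - i)" using h KG g by simp
    then have "g [^] (j - i) = inv h' \<otimes> h" using h KG g by (simp add: m_assoc[symmetric])
    then have "g [^] (j - i) \<in> K" using h sub by (simp add: subgroup.m_closed subgroup.m_inv_closed)
    then obtain t where t: "j - i = k * t" using dvd by blast
    have *: "g [^] (j - i) = (g [^] k) [^] t" using g by (simp add: t nat_pow_pow)
    have "\<chi> h = \<chi> h' * \<chi> ((g [^] k) [^] t)"
      using eq mult[OF h(2)] partial_char_pow[OF K k(2)] unfolding * by metis
    also have "\<chi> ((g [^] k) [^] t) = c ^ (k * t)"
      using partial_char_pow[OF K k(2)] by (simp add: power_mult c)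
    finally have "\<chi> h = \<chi> h' * c ^ (k * t)" .
    moreover have "j = k * t + i" using le t by simp
    ultimately show ?thesis by (simp add: power_add)
  qed
  have wd: "\<chi> h * c ^ i = \<chi> h' * c ^ j"
    if "h \<in> K" "h' \<in> K" "h \<otimes> g [^] i = h' \<otimes> g [^] j" for h h' and i j :: nat
    using that wd_le[of h h' i j] wd_le[of h' h j i] by (metis nat_le_linear)
  have \<chi>': "\<chi>' (h \<otimes> g [^] j) = \<chi> h * c ^ j" if "h \<in> K" for h and j :: nat
    unfolding \<chi>'_def
  proof (rule some_equality)
    show "\<exists>h' i. h' \<in> K \<and> h \<otimes> g [^] j = h' \<otimes> g [^] i \<and> \<chi> h * c ^ j = \<chi> h' * c ^ i"
      using that by blast
  qed (use that wd in metis)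
  have prod: "(h \<otimes> g [^] i) \<otimes> (h' \<otimes> g [^] j) = (h \<otimes> h') \<otimes> g [^] (i + j)"
    if "h \<in> K" "h' \<in> K" for h h' and i j :: nat
    using that KG g by (simp add: nat_pow_mult[symmetric] m_ac)
  have "subgroup K' G"
  proof (rule subgroupI)
    show "K' \<subseteq> carrier G" using KG g by (auto simp: K'_def)
    show "K' \<noteq> {}" using subgroup.one_closed[OF sub] by (auto simp: K'_def)
    fix x assume "x \<in> K'"
    then obtain h j where x: "x = h \<otimes> g [^] (j::nat)" "h \<in> K" by (auto simp: K'_def)
    have kj: "(g [^] k) [^] j \<in> K" using partial_char_pow[OF K k(2)] by blast
    have perm: "(u \<otimes> a) \<otimes> b \<otimes> (v \<otimes> d) = a \<otimes> (b \<otimes> d) \<otimes> (u \<otimes> v)"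
      if "u \<in> carrier G" "v \<in> carrier G" "a \<in> carrier G" "b \<in> carrier G" "d \<in> carrier G" for u v a b d
      using that by (simp add: m_ac)
    \<comment> \<open>Elements of \<open>K'\<close> carry natural exponents only, so the inverse of
      \<open>g [^] j\<close> is written as the inverse of \<open>(g [^] k) [^] j\<close>, which lies
      in \<open>K\<close>, times \<open>g [^] ((k - 1) * j)\<close>.\<close>
    have "inv x = (inv h \<otimes> inv ((g [^] k) [^] j)) \<otimes> g [^] ((k - 1) * j)"
    proof (rule inv_equality)
      have "(inv h \<otimes> inv ((g [^] k) [^] j)) \<otimes> g [^] ((k - 1) * j) \<otimes> x
        = inv ((g [^] k) [^] j) \<otimes> (g [^] ((k - 1) * j) \<otimes> g [^] j) \<otimes> (inv h \<otimes> h)"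
        unfolding x(1) using x(2) KG g by (intro perm) auto
      also have "g [^] ((k - 1) * j) \<otimes> g [^] j = (g [^] k) [^] j"
        using g k by (simp add: nat_pow_mult nat_pow_pow algebra_simps)
      finally show "(inv h \<otimes> inv ((g [^] k) [^] j)) \<otimes> g [^] ((k - 1) * j) \<otimes> x = \<one>"
        using x KG g by simp
    qed (use x KG g in auto)
    moreover have "inv h \<otimes> inv ((g [^] k) [^] j) \<in> K"
      using kj x sub by (simp add: subgroup.m_closed subgroup.m_inv_closed)
    ultimately show "inv x \<in> K'" by (auto simp: K'_def)
    fix y assume "y \<in> K'"
    then obtain h' i where y: "y = h' \<otimes> g [^] (i::nat)" "h' \<in> K" by (auto simp: K'_def)
    show "x \<otimes> y \<in> K'" unfolding x(1) y(1) prod[OF x(2) y(2)] K'_def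
      using x y sub by (auto intro: subgroup.m_closed)
  qed
  moreover have "\<chi>' x = \<chi> x" if "x \<in> K" for x
    using \<chi>'[OF that, of 0] KG[OF that] by simp
  moreover have "\<chi>' g = c"
    using \<chi>'[OF subgroup.one_closed[OF sub], of 1] g one by simp
  moreover have "\<chi>' (x \<otimes> y) = \<chi>' x * \<chi>' y" if xy: "x \<in> K'" "y \<in> K'" for x y
  proof -
    obtain h j where x: "x = h \<otimes> g [^] (j::nat)" "h \<in> K" using xy by (auto simp: K'_def)
    obtain h' i where y: "y = h' \<otimes> g [^] (i::nat)" "h' \<in> K" using xy by (auto simp: K'_def)
    have "h \<otimes> h' \<in> K" using x y sub by (auto intro: subgroup.m_closed)
    then show ?thesis
      unfolding x(1) y(1) prod[OF x(2) y(2)] by (simp add: \<chi>' x y mult power_add)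
  qed
  moreover have "K \<subseteq> K'"
  proof
    fix x assume "x \<in> K"
    then have "x = x \<otimes> g [^] (0::nat)" using KG by simp
    then show "x \<in> K'" using \<open>x \<in> K\<close> unfolding K'_def by blast
  qed
  moreover have "g \<in> K'"
  proof -
    have "g = \<one> \<otimes> g [^] (1::nat)" using g by simp
    then show ?thesis using subgroup.one_closed[OF sub] unfolding K'_def by blast
  qed
  ultimately show ?thesis using one subgroup.one_closed[OF sub]
    unfolding partial_char_def by metis
qed

text \<open>The number \<open>k\<close> is the order of the coset of \<open>g\<close> modulo
  \<open>K\<close>. The order of \<open>G\<close> is a positive exponent landing in
  \<open>K\<close>, and division with remainder shows that the least one divides all others.\<close>

lemma (in group) pow_in_subgroup_dvd:
  assumes fin: "finite (carrier G)" and sub: "subgroup K G" and g: "g \<in> carrier G"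
  shows "\<exists>k>0. g [^] k \<in> K \<and> (\<forall>j. g [^] j \<in> K \<longrightarrow> k dvd (j::nat))"
proof -
  define k where "k = (LEAST k. k > 0 \<and> g [^] (k::nat) \<in> K)"
  have "Coset.order G > 0 \<and> g [^] Coset.order G \<in> K"
    using fin g by (simp add: pow_order_eq_1 subgroup.one_closed[OF sub] order_gt_0_iff_finite)
  then have k: "k > 0" "g [^] k \<in> K" unfolding k_def by (metis (mono_tags, lifting) LeastI)+
  have min: "\<not> (j > 0 \<and> g [^] j \<in> K)" if "j < k" for j
    using that not_less_Least unfolding k_def by blast
  have "k dvd j" if j: "g [^] j \<in> K" for j
  proof -
    have K: "(g [^] k) [^] t \<in> K" for t :: nat
      by (induction t) (use k sub in \<open>auto intro: subgroup.m_closed subgroup.one_closed\<close>)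
    have "g [^] j = (g [^] k) [^] (j div k) \<otimes> g [^] (j mod k)"
      using g by (simp add: nat_pow_pow nat_pow_mult)
    then have "g [^] (j mod k) = inv ((g [^] k) [^] (j div k)) \<otimes> g [^] j"
      using g by (simp add: m_assoc[symmetric])
    then have "g [^] (j mod k) \<in> K"
      using j K sub by (simp add: subgroup.m_closed subgroup.m_inv_closed)
    then show ?thesis using min[of "j mod k"] k by (simp add: mod_eq_0_iff_dvd[symmetric])
  qed
  then show ?thesis using k by blast
qed

text \<open>A subgroup that is maximal among those carrying a character nontrivial at
  \<open>a\<close> must be all of \<open>G\<close>, since any missing element could be adjoined.
  Finiteness provides a maximal one.\<close>

lemma (in comm_group) chars_separate:
  assumes fin: "finite (carrier G)" and a: "a \<in> carrier G" "a \<noteq> \<one>"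
  shows "\<exists>\<chi>\<in>chars G. \<chi> a \<noteq> 1"
proof -
  define S where "S = {K. \<exists>\<chi>. partial_char G K \<chi> \<and> a \<in> K \<and> \<chi> a \<noteq> 1}"
  have "S \<subseteq> Pow (carrier G)" unfolding S_def partial_char_def using subgroup.subset by auto
  then have finS: "finite S" using fin by (meson finite_Pow_iff finite_subset)
  have "S \<noteq> {}"
  proof -
    \<comment> \<open>Adjoining \<open>a\<close> to the trivial subgroup starts the process:
      \<open>k\<close> is then the order of \<open>a\<close>, which exceeds 1, so \<open>c\<close>
      can be a root of unity other than 1.\<close>
    have triv: "partial_char G {\<one>} (\<lambda>_. 1)" by (simp add: partial_char_def triv_subgroup)
    obtain k where k: "k > 0" "a [^] k \<in> {\<one>}" "\<And>j. a [^] j \<in> {\<one>} \<Longrightarrow> k dvd (j::nat)"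
      using pow_in_subgroup_dvd[OF fin triv_subgroup a(1)] by blast
    have "k \<noteq> 1" using k(2) a by auto
    then obtain c :: complex where "c ^ k = 1" "c \<noteq> 1" using nontrivial_root_of_unity[of k] k(1) by auto
    then show ?thesis using partial_char_adjoin[OF triv a(1) k(1,2,3), of c] unfolding S_def by auto
  qed
  then obtain K where K: "K \<in> S" "\<And>K'. K' \<in> S \<Longrightarrow> K \<subseteq> K' \<Longrightarrow> K = K'"
    using finite_has_maximal[OF finS] by auto
  then obtain \<chi> where \<chi>: "partial_char G K \<chi>" "a \<in> K" "\<chi> a \<noteq> 1" unfolding S_def by auto
  then have sub: "subgroup K G" by (simp add: partial_char_def)
  have "carrier G \<subseteq> K"
  proof
    fix g assume g: "g \<in> carrier G"
    obtain k where k: "k > 0" "g [^] k \<in> K" "\<And>j. g [^] j \<in> K \<Longrightarrow> k dvd (j::nat)"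
      using pow_in_subgroup_dvd[OF fin sub g] by blast
    obtain c where c: "c ^ k = \<chi> (g [^] k)" using complex_root_exists[OF k(1)] by blast
    obtain K' \<chi>' where *: "partial_char G K' \<chi>'" "K \<subseteq> K'" "g \<in> K'" "\<forall>x\<in>K. \<chi>' x = \<chi> x"
      using partial_char_adjoin[OF \<chi>(1) g k c] by blast
    then have "K' \<in> S" using \<chi> unfolding S_def by auto
    then show "g \<in> K" using K(2) * by blast
  qed
  then have "K = carrier G" using subgroup.subset[OF sub] by blast
  then have "restrict \<chi> (carrier G) \<in> chars G"
    using \<chi>(1) by (intro charsI) (auto simp: partial_char_def is_monoid)
  then show ?thesis using \<chi> a by (intro bexI[of _ "restrict \<chi> (carrier G)"]) auto
qed

section \<open>Orthogonality relations and the number of characters\<close>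

lemma (in group) chars_inv:
  assumes "\<chi> \<in> chars G" "x \<in> carrier G"
  shows "\<chi> (inv x) * \<chi> x = 1"
  using chars_mult[OF assms(1), of "inv x" x] assms chars_one[OF assms(1)] by simp

lemma (in group) chars_nonzero: "\<chi> \<in> chars G \<Longrightarrow> x \<in> carrier G \<Longrightarrow> \<chi> x \<noteq> 0"
  using chars_inv by fastforce

lemma (in group) finite_chars:
  assumes fin: "finite (carrier G)"
  shows "finite (chars G)"
proof (rule finite_subset)
  have pow: "\<chi> (x [^] n) = \<chi> x ^ n" if "\<chi> \<in> chars G" "x \<in> carrier G" for \<chi> x and n :: nat
    using that by (induction n) (auto simp: chars_mult chars_one)
  have "\<chi> x ^ Coset.order G = 1" if "\<chi> \<in> chars G" "x \<in> carrier G" for \<chi> x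
    using that by (simp add: pow[symmetric] pow_order_eq_1 chars_one)
  then show "chars G \<subseteq> carrier G \<rightarrow>\<^sub>E {z. z ^ Coset.order G = 1}" by (auto simp: chars_def)
  have "finite {z::complex. z ^ Coset.order G = 1}"
    using order_gt_0_iff_finite fin by (intro finite_roots_unity) (simp add: Suc_leI)
  then show "finite (carrier G \<rightarrow>\<^sub>E {z::complex. z ^ Coset.order G = 1})" using fin by (intro finite_PiE)
qed

lemma (in group) trivial_char: "restrict (\<lambda>_. 1) (carrier G) \<in> chars G"
  by (rule charsI) (auto simp: is_monoid)

text \<open>Translation by an \<open>a\<close> with \<open>\<chi> a \<noteq> 1\<close> permutes the
  summands and multiplies the sum by \<open>\<chi> a\<close>.\<close>

lemma (in group) sum_char:
  assumes fin: "finite (carrier G)" and \<chi>: "\<chi> \<in> chars G" "\<chi> \<noteq> restrict (\<lambda>_. 1) (carrier G)"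
  shows "(\<Sum>x\<in>carrier G. \<chi> x) = 0"
proof -
  obtain a where a: "a \<in> carrier G" "\<chi> a \<noteq> 1"
    using chars_eqI[OF \<chi>(1) trivial_char] \<chi>(2) by auto
  have "(\<Sum>x\<in>carrier G. \<chi> x) = (\<Sum>x\<in>carrier G. \<chi> (a \<otimes> x))"
    by (rule sum.reindex_bij_witness[of _ "\<lambda>x. a \<otimes> x" "\<lambda>x. inv a \<otimes> x"])
      (use a in \<open>auto simp: m_assoc[symmetric]\<close>)
  also have "\<dots> = \<chi> a * (\<Sum>x\<in>carrier G. \<chi> x)"
    using a \<chi> by (simp add: chars_mult sum_distrib_left)
  finally show ?thesis using a(2) by simp
qed

text \<open>Multiplication by a character \<open>\<psi>\<close> with
  \<open>\<psi> a \<noteq> 1\<close> permutes \<open>chars G\<close> and scales the sum by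
  \<open>\<psi> a\<close>. The existence of \<open>\<psi>\<close> is where separation of points
  enters.\<close>

lemma (in comm_group) sum_over_chars:
  assumes fin: "finite (carrier G)" and a: "a \<in> carrier G" "a \<noteq> \<one>"
  shows "(\<Sum>\<chi>\<in>chars G. \<chi> a) = 0"
proof -
  obtain \<psi> where \<psi>: "\<psi> \<in> chars G" "\<psi> a \<noteq> 1" using chars_separate[OF assms] by blast
  let ?m = "\<lambda>\<psi> \<chi>. restrict (\<lambda>x. \<psi> x * \<chi> x) (carrier G)"
  let ?i = "restrict (\<lambda>x. \<psi> (inv x)) (carrier G)"
  have mc: "?m \<psi> \<chi> \<in> chars G" if "\<psi> \<in> chars G" "\<chi> \<in> chars G" for \<psi> \<chi>
    using that by (intro charsI) (auto simp: chars_one chars_mult is_monoid)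
  have ic: "?i \<in> chars G"
    using \<psi>(1) by (intro charsI) (auto simp: chars_one chars_mult is_monoid inv_mult)
  have "(\<Sum>\<chi>\<in>chars G. \<chi> a) = (\<Sum>\<chi>\<in>chars G. ?m \<psi> \<chi> a)"
  proof (rule sum.reindex_bij_witness[of _ "?m \<psi>" "?m ?i"])
    fix \<chi> assume \<chi>: "\<chi> \<in> chars G"
    show "?m ?i \<chi> \<in> chars G" "?m \<psi> \<chi> \<in> chars G" using mc \<psi>(1) ic \<chi> by blast+
    have "\<psi> x * (\<psi> (inv x) * \<chi> x) = \<chi> x" "\<psi> (inv x) * (\<psi> x * \<chi> x) = \<chi> x" if "x \<in> carrier G" for x
      using chars_inv[OF \<psi>(1) that] by (metis mult.assoc mult.commute mult_1)+
    then show *: "?m \<psi> (?m ?i \<chi>) = \<chi>" "?m ?i (?m \<psi> \<chi>) = \<chi>"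
      using chars_eqI[OF mc[OF \<psi>(1) mc[OF ic \<chi>]] \<chi>] chars_eqI[OF mc[OF ic mc[OF \<psi>(1) \<chi>]] \<chi>]
      by auto
    show "?m \<psi> (?m ?i \<chi>) a = \<chi> a" unfolding * ..
  qed
  also have "\<dots> = \<psi> a * (\<Sum>\<chi>\<in>chars G. \<chi> a)"
    using a by (simp add: sum_distrib_left)
  finally show ?thesis using \<psi>(2) by simp
qed

text \<open>Sum \<open>\<chi> x\<close> over all pairs: one order of summation leaves only the
  trivial character, the other only the identity element.\<close>

lemma (in comm_group) card_chars:
  assumes fin: "finite (carrier G)"
  shows "card (chars G) = card (carrier G)"
proof -
  let ?t = "restrict (\<lambda>_. 1 :: complex) (carrier G)"
  have "(\<Sum>\<chi>\<in>chars G. \<Sum>x\<in>carrier G. \<chi> x) = (\<Sum>\<chi>\<in>chars G. if \<chi> = ?t then of_nat (card (carrier G)) else 0)"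
    by (rule sum.cong) (auto simp: sum_char[OF fin])
  also have "\<dots> = of_nat (card (carrier G))"
    using trivial_char finite_chars[OF fin] by simp
  finally have *: "(\<Sum>\<chi>\<in>chars G. \<Sum>x\<in>carrier G. \<chi> x) = of_nat (card (carrier G))" .
  have "(\<Sum>x\<in>carrier G. \<Sum>\<chi>\<in>chars G. \<chi> x) = (\<Sum>x\<in>carrier G. if x = \<one> then of_nat (card (chars G)) else 0)"
    by (rule sum.cong) (auto simp: sum_over_chars[OF fin] chars_one)
  also have "\<dots> = of_nat (card (chars G))" using fin by simp
  finally show ?thesis using * by (subst (asm) sum.swap) (metis of_nat_eq_iff)
qed

text \<open>Pairing the relation with the inverse of \<open>\<chi> i\<close> and summing over the
  group isolates \<open>c i\<close>. Scalar coefficients suffice, because relations between weight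
  vectors are treated one coordinate at a time.\<close>

lemma (in comm_group) chars_independent:
  assumes fin: "finite (carrier G)" and I: "finite I" "inj_on \<chi> I" "\<And>i. i \<in> I \<Longrightarrow> \<chi> i \<in> chars G"
    and zero: "\<And>x. x \<in> carrier G \<Longrightarrow> (\<Sum>i\<in>I. \<chi> i x * c i) = 0" and i: "i \<in> I"
  shows "c i = 0"
proof -
  have orth: "(\<Sum>x\<in>carrier G. \<chi> i (inv x) * \<chi> j x) = (if j = i then of_nat (card (carrier G)) else 0)"
    if j: "j \<in> I" for j
  proof (cases "j = i")
    case True
    then show ?thesis using chars_inv[OF I(3)[OF i]] by simp
  next
    case False
    let ?\<psi> = "restrict (\<lambda>x. \<chi> i (inv x) * \<chi> j x) (carrier G)"
    have \<psi>: "?\<psi> \<in> chars G"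
      using I(3)[OF i] I(3)[OF j] by (intro charsI) (auto simp: chars_one chars_mult is_monoid inv_mult)
    have "\<chi> j \<noteq> \<chi> i" using False i j I(2) by (auto dest: inj_onD)
    then obtain x where x: "x \<in> carrier G" "\<chi> j x \<noteq> \<chi> i x"
      using chars_eqI[OF I(3)[OF j] I(3)[OF i]] by blast
    have "\<chi> i (inv x) * \<chi> j x \<noteq> \<chi> i (inv x) * \<chi> i x"
      using x chars_nonzero[OF I(3)[OF i], of "inv x"] by simp
    then have "?\<psi> x \<noteq> 1" using x(1) chars_inv[OF I(3)[OF i] x(1)] by simp
    then have "?\<psi> \<noteq> restrict (\<lambda>_. 1) (carrier G)" using x(1) by (auto dest: fun_cong[where x = x])
    then have "(\<Sum>x\<in>carrier G. ?\<psi> x) = 0" using sum_char[OF fin \<psi>] by blast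
    then show ?thesis using False by simp
  qed
  have "0 = (\<Sum>x\<in>carrier G. \<chi> i (inv x) * (\<Sum>j\<in>I. \<chi> j x * c j))" using zero by simp
  also have "\<dots> = (\<Sum>x\<in>carrier G. \<Sum>j\<in>I. \<chi> i (inv x) * \<chi> j x * c j)"
    by (simp add: sum_distrib_left mult.assoc)
  also have "\<dots> = (\<Sum>j\<in>I. (\<Sum>x\<in>carrier G. \<chi> i (inv x) * \<chi> j x) * c j)"
    by (subst sum.swap) (simp add: sum_distrib_right)
  also have "\<dots> = (\<Sum>j\<in>I. (if j = i then of_nat (card (carrier G)) * c j else 0))"
    by (rule sum.cong) (auto simp: orth)
  also have "\<dots> = of_nat (card (carrier G)) * c i" using I(1) i by simp
  finally show ?thesis using fin by auto
qed

section \<open>Matrix representations\<close>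

lemma GL_iff: "P \<in> carrier (GL n) \<longleftrightarrow>
  P \<in> carrier_mat n n \<and> (\<exists>Q\<in>carrier_mat n n. Q * P = 1\<^sub>m n \<and> P * Q = 1\<^sub>m n)"
  by (auto simp: GL_def units_of_def Units_def ring_mat_def)

lemma group_GL: "group (GL n)"
  unfolding GL_def by (intro monoid.units_group ring.is_monoid ring_mat)

lemma GL_simps: "mult (GL n) = (*)" "\<one>\<^bsub>GL n\<^esub> = 1\<^sub>m n"
  by (auto simp: GL_def units_of_def ring_mat_def)

lemma
  assumes "representation G n \<rho>"
  shows rep_carrier: "g \<in> carrier G \<Longrightarrow> \<rho> g \<in> carrier_mat n n"
    and rep_mult: "g \<in> carrier G \<Longrightarrow> h \<in> carrier G \<Longrightarrow> \<rho> (g \<otimes>\<^bsub>G\<^esub> h) = \<rho> g * \<rho> h"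
    and rep_one: "group G \<Longrightarrow> \<rho> \<one>\<^bsub>G\<^esub> = 1\<^sub>m n"
proof -
  have hom: "\<rho> \<in> hom G (GL n)" using assms by (simp add: representation_def)
  show "g \<in> carrier G \<Longrightarrow> \<rho> g \<in> carrier_mat n n"
    using hom_carrier[OF hom] by (auto simp: GL_iff)
  show "g \<in> carrier G \<Longrightarrow> h \<in> carrier G \<Longrightarrow> \<rho> (g \<otimes>\<^bsub>G\<^esub> h) = \<rho> g * \<rho> h"
    using hom_mult[OF hom] by (simp add: GL_simps)
  show "group G \<Longrightarrow> \<rho> \<one>\<^bsub>G\<^esub> = 1\<^sub>m n"
    using hom_one[OF hom _ group_GL] by (simp add: GL_simps)
qed

lemma rep_mult_vec:
  assumes "representation G n \<rho>" "g \<in> carrier G" "h \<in> carrier G" "v \<in> carrier_vec n"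
  shows "\<rho> g *\<^sub>v (\<rho> h *\<^sub>v v) = \<rho> (g \<otimes>\<^bsub>G\<^esub> h) *\<^sub>v v"
  using assms rep_carrier[OF assms(1)] by (simp add: rep_mult assoc_mult_mat_vec[of _ n n _ n])

lemma representationI:
  assumes "group G" and c: "\<And>g. g \<in> carrier G \<Longrightarrow> \<rho> g \<in> carrier_mat n n"
    and m: "\<And>g h. g \<in> carrier G \<Longrightarrow> h \<in> carrier G \<Longrightarrow> \<rho> (g \<otimes>\<^bsub>G\<^esub> h) = \<rho> g * \<rho> h"
    and o: "\<rho> \<one>\<^bsub>G\<^esub> = 1\<^sub>m n"
  shows "representation G n \<rho>"
  unfolding representation_def
proof (rule homI)
  interpret group G by fact
  fix g assume g: "g \<in> carrier G"
  show "\<rho> g \<in> carrier (GL n)"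
    unfolding GL_iff using g c m[of g "inv\<^bsub>G\<^esub> g"] m[of "inv\<^bsub>G\<^esub> g" g] o
    by (intro conjI bexI[of _ "\<rho> (inv\<^bsub>G\<^esub> g)"]) auto
qed (simp add: m GL_simps)

section \<open>Subspaces and finite sums of vectors\<close>

abbreviation vec_subspace :: "nat \<Rightarrow> complex vec set \<Rightarrow> bool" where
  "vec_subspace n W \<equiv> VectorSpace.subspace class_ring W (module_vec TYPE(complex) n)"

lemma vec_subspace_iff: "vec_subspace n W \<longleftrightarrow> W \<subseteq> carrier_vec n \<and> 0\<^sub>v n \<in> W \<and>
  (\<forall>v\<in>W. \<forall>w\<in>W. v + w \<in> W) \<and> (\<forall>c. \<forall>v\<in>W. c \<cdot>\<^sub>v v \<in> W)"
  unfolding VectorSpace.subspace_def submodule_def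
  by (auto simp: vec_vs vec_module module_vec_simps)

text \<open>The explicit length \<open>n\<close> gives the empty sum a definite dimension.\<close>

definition vsum :: "nat \<Rightarrow> 'b set \<Rightarrow> ('b \<Rightarrow> complex vec) \<Rightarrow> complex vec" where
  "vsum n A f = vec n (\<lambda>i. \<Sum>a\<in>A. f a $ i)"

lemma vsum_carrier [simp]: "vsum n A f \<in> carrier_vec n"
  by (simp add: vsum_def)

lemma vsum_closed:
  assumes W: "vec_subspace n W" and A: "finite A" "\<And>a. a \<in> A \<Longrightarrow> f a \<in> W"
  shows "vsum n A f \<in> W"
  using A
proof (induction A)
  case empty
  have "vsum n {} f = 0\<^sub>v n" by (auto simp: vsum_def)
  then show ?case using W by (simp add: vec_subspace_iff)
next
  case (insert a A)
  have "f a \<in> carrier_vec n" using insert W by (auto simp: vec_subspace_iff)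
  then have "vsum n (insert a A) f = f a + vsum n A f"
    using insert by (intro eq_vecI) (auto simp: vsum_def)
  then show ?case using insert W by (simp add: vec_subspace_iff)
qed

lemma mult_mat_vsum:
  assumes M: "M \<in> carrier_mat m n" and f: "\<And>a. a \<in> A \<Longrightarrow> f a \<in> carrier_vec n"
  shows "M *\<^sub>v vsum n A f = vsum m A (\<lambda>a. M *\<^sub>v f a)"
proof (rule eq_vecI)
  fix i assume "i < dim_vec (vsum m A (\<lambda>a. M *\<^sub>v f a))"
  then have i: "i < m" by (simp add: vsum_def)
  have "(M *\<^sub>v vsum n A f) $ i = (\<Sum>j<n. \<Sum>a\<in>A. M $$ (i,j) * f a $ j)"
    using M i by (auto simp: vsum_def scalar_prod_def sum_distrib_left atLeast0LessThan intro!: sum.cong)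
  also have "\<dots> = (\<Sum>a\<in>A. \<Sum>j<n. M $$ (i,j) * f a $ j)" by (rule sum.swap)
  also have "\<dots> = (\<Sum>a\<in>A. (M *\<^sub>v f a) $ i)"
  proof (rule sum.cong)
    fix a assume "a \<in> A"
    then have "dim_vec (f a) = n" using f by (simp add: carrier_vecD)
    then show "(\<Sum>j<n. M $$ (i,j) * f a $ j) = (M *\<^sub>v f a) $ i"
      using M i by (auto simp: scalar_prod_def atLeast0LessThan intro!: sum.cong)
  qed simp
  finally show "(M *\<^sub>v vsum n A f) $ i = vsum m A (\<lambda>a. M *\<^sub>v f a) $ i" using i by (simp add: vsum_def)
qed (use M in \<open>auto simp: vsum_def\<close>)

lemma vec_as_vsum:
  assumes "v \<in> carrier_vec n"
  shows "v = vsum n {0..<n} (\<lambda>j. v $ j \<cdot>\<^sub>v unit_vec n j)"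
proof (rule eq_vecI)
  fix i assume "i < dim_vec (vsum n {0..<n} (\<lambda>j. v $ j \<cdot>\<^sub>v unit_vec n j))"
  then have "i < n" by (simp add: vsum_def)
  then have "vsum n {0..<n} (\<lambda>j. v $ j \<cdot>\<^sub>v unit_vec n j) $ i = (\<Sum>j\<in>{0..<n}. if j = i then v $ j else 0)"
    unfolding vsum_def by (simp only: index_vec) (rule sum.cong, auto)
  then show "v $ i = vsum n {0..<n} (\<lambda>j. v $ j \<cdot>\<^sub>v unit_vec n j) $ i" using \<open>i < n\<close> by simp
qed (use assms in \<open>simp add: vsum_def\<close>)

lemma mat_mult_vec_as_vsum:
  assumes M: "M \<in> carrier_mat n m" and v: "v \<in> carrier_vec m"
  shows "M *\<^sub>v v = vsum n {0..<m} (\<lambda>j. v $ j \<cdot>\<^sub>v col M j)"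
  using assms by (intro eq_vecI) (auto simp: vsum_def scalar_prod_def intro!: sum.cong)

text \<open>The summands are the isotypic projections
  \<open>1/|G| * (\<Sum>a. \<chi> (inv a) * \<rho> a)\<close> applied to \<open>v\<close>; they add up to \<open>v\<close> by the
  dual orthogonality relation.\<close>

lemma (in comm_group) rep_char_decomposition:
  assumes fin: "finite (carrier G)" and rep: "representation G n \<rho>" and v: "v \<in> carrier_vec n"
  shows "\<exists>u. (\<forall>\<chi>\<in>chars G. u \<chi> \<in> carrier_vec n \<and> (\<forall>a\<in>carrier G. \<rho> a *\<^sub>v u \<chi> = \<chi> a \<cdot>\<^sub>v u \<chi>) \<and>
      (\<forall>W. vec_subspace n W \<longrightarrow> (\<forall>a\<in>carrier G. \<forall>w\<in>W. \<rho> a *\<^sub>v w \<in> W) \<longrightarrow> v \<in> W \<longrightarrow> u \<chi> \<in> W)) \<and>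
    v = vsum n (chars G) u"
proof -
  define N where "N = (of_nat (card (carrier G)) :: complex)"
  have N: "N \<noteq> 0" using fin by (auto simp: N_def)
  define w where "w \<chi> a = (\<chi> (inv a) / N) \<cdot>\<^sub>v (\<rho> a *\<^sub>v v)" for \<chi> :: "'a \<Rightarrow> complex" and a
  have rc: "\<rho> a \<in> carrier_mat n n" if "a \<in> carrier G" for a using rep_carrier[OF rep that] .
  have w: "w \<chi> a \<in> carrier_vec n" if "a \<in> carrier G" for \<chi> a using rc[OF that] v by (simp add: w_def)
  define u where "u \<chi> = vsum n (carrier G) (w \<chi>)" for \<chi>
  have eig: "\<rho> b *\<^sub>v u \<chi> = \<chi> b \<cdot>\<^sub>v u \<chi>" if \<chi>: "\<chi> \<in> chars G" and b: "b \<in> carrier G" for \<chi> b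
  proof (rule eq_vecI)
    fix i assume "i < dim_vec (\<chi> b \<cdot>\<^sub>v u \<chi>)"
    then have i: "i < n" by (simp add: u_def vsum_def)
    \<comment> \<open>Applying \<open>\<rho> b\<close> shifts the summation index from
      \<open>a\<close> to \<open>b \<otimes> a\<close>; rewriting the coefficient in the new index
      releases the factor \<open>\<chi> b\<close>.\<close>
    have step: "\<rho> b *\<^sub>v w \<chi> a = \<chi> b \<cdot>\<^sub>v w \<chi> (b \<otimes> a)" if a: "a \<in> carrier G" for a
    proof -
      have "\<rho> b *\<^sub>v w \<chi> a = (\<chi> (inv a) / N) \<cdot>\<^sub>v (\<rho> (b \<otimes> a) *\<^sub>v v)"
        using mult_mat_vec[OF rc[OF b] mult_mat_vec_carrier[OF rc[OF a] v]] rep_mult_vec[OF rep b a v]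
        by (simp add: w_def)
      moreover have "\<chi> b * \<chi> (inv (b \<otimes> a)) = \<chi> (inv a)"
        using a b \<chi> by (simp add: chars_mult[OF \<chi>, symmetric] inv_mult m_assoc[symmetric])
      ultimately show ?thesis by (simp add: w_def smult_smult_assoc)
    qed
    have "(\<rho> b *\<^sub>v u \<chi>) $ i = (\<Sum>a\<in>carrier G. (\<rho> b *\<^sub>v w \<chi> a) $ i)"
      unfolding u_def using i by (simp add: mult_mat_vsum[OF rc[OF b] w]) (simp add: vsum_def)
    also have "\<dots> = (\<Sum>a\<in>carrier G. \<chi> b * w \<chi> (b \<otimes> a) $ i)"
    proof (rule sum.cong)
      fix a assume a: "a \<in> carrier G"
      have "dim_vec (w \<chi> (b \<otimes> a)) = n" using w[of "b \<otimes> a"] a b by (simp add: carrier_vecD)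
      then show "(\<rho> b *\<^sub>v w \<chi> a) $ i = \<chi> b * w \<chi> (b \<otimes> a) $ i" using step[OF a] i by simp
    qed simp
    also have "\<dots> = (\<Sum>a\<in>carrier G. \<chi> b * w \<chi> a $ i)"
      by (rule sum.reindex_bij_witness[of _ "\<lambda>a. inv b \<otimes> a" "\<lambda>a. b \<otimes> a"])
        (use b in \<open>auto simp: m_assoc[symmetric]\<close>)
    finally show "(\<rho> b *\<^sub>v u \<chi>) $ i = (\<chi> b \<cdot>\<^sub>v u \<chi>) $ i"
      using i by (simp add: u_def vsum_def sum_distrib_left)
  qed (use rc[OF b] in \<open>simp add: u_def vsum_def\<close>)
  \<comment> \<open>Each component is a linear combination of translates of \<open>v\<close>, so it
    stays in every invariant subspace containing \<open>v\<close>. This is what lets irreducibility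
    be tested on weight vectors.\<close>
  have inW: "u \<chi> \<in> W" if "vec_subspace n W" "\<forall>a\<in>carrier G. \<forall>w\<in>W. \<rho> a *\<^sub>v w \<in> W" "v \<in> W" for \<chi> W
    unfolding u_def using that fin by (intro vsum_closed) (auto simp: w_def vec_subspace_iff)
  have "v = vsum n (chars G) u"
  proof (rule eq_vecI)
    fix i assume "i < dim_vec (vsum n (chars G) u)"
    then have i: "i < n" by (simp add: vsum_def)
    have "vsum n (chars G) u $ i = (\<Sum>\<chi>\<in>chars G. \<Sum>a\<in>carrier G. w \<chi> a $ i)"
      using i by (simp add: vsum_def u_def)
    also have "\<dots> = (\<Sum>a\<in>carrier G. \<Sum>\<chi>\<in>chars G. w \<chi> a $ i)" by (rule sum.swap)
    also have "\<dots> = (\<Sum>a\<in>carrier G. (\<Sum>\<chi>\<in>chars G. \<chi> (inv a)) / N * (\<rho> a *\<^sub>v v) $ i)"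
    proof (rule sum.cong)
      fix a assume a: "a \<in> carrier G"
      have "dim_vec (\<rho> a *\<^sub>v v) = n" using rc[OF a] by simp
      then show "(\<Sum>\<chi>\<in>chars G. w \<chi> a $ i) = (\<Sum>\<chi>\<in>chars G. \<chi> (inv a)) / N * (\<rho> a *\<^sub>v v) $ i"
        using i by (simp add: w_def sum_distrib_right sum_divide_distrib)
    qed simp
    also have "\<dots> = (\<Sum>a\<in>carrier G. if a = \<one> then (\<rho> a *\<^sub>v v) $ i else 0)"
      using sum_over_chars[OF fin] N
      by (intro sum.cong) (auto simp: chars_one card_chars[OF fin] N_def)
    also have "\<dots> = v $ i" using fin v rep_one[OF rep is_group] by simp
    finally show "v $ i = vsum n (chars G) u $ i" by simp
  qed (use v in \<open>simp add: vsum_def\<close>)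
  moreover have "u \<chi> \<in> carrier_vec n" for \<chi> by (simp add: u_def)
  ultimately show ?thesis using eig inW by (intro exI[of _ u] conjI ballI allI impI)
qed

section \<open>Injective and bijective matrices\<close>

text \<open>If \<open>n < m\<close>, padding \<open>Q\<close> with zero rows gives a singular square
  matrix, whose kernel is also killed by \<open>Q\<close>.\<close>

lemma injective_mat_dim_le:
  fixes Q :: "'a::field mat"
  assumes Q: "Q \<in> carrier_mat n m" and inj: "\<And>x. x \<in> carrier_vec m \<Longrightarrow> Q *\<^sub>v x = 0\<^sub>v n \<Longrightarrow> x = 0\<^sub>v m"
  shows "m \<le> n"
proof (rule ccontr)
  assume "\<not> m \<le> n"
  then have nm: "n < m" by simp
  define Q' where "Q' = mat m m (\<lambda>(i,j). if i < n then Q $$ (i,j) else 0)"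
  have Q': "Q' \<in> carrier_mat m m" by (simp add: Q'_def)
  have "Q' = mat\<^sub>r m m (\<lambda>i. if i = n then 0\<^sub>v m else row Q' i)"
    by (rule eq_matI) (auto simp: Q'_def)
  then have "det Q' = 0" using det_row_0[OF nm, of "row Q'"] Q' by auto
  then obtain x where x: "x \<in> carrier_vec m" "x \<noteq> 0\<^sub>v m" "Q' *\<^sub>v x = 0\<^sub>v m"
    using det_0_iff_vec_prod_zero_field[OF Q'] by blast
  have "Q *\<^sub>v x = 0\<^sub>v n"
  proof (rule eq_vecI)
    fix i assume "i < dim_vec (0\<^sub>v n)"
    then have i: "i < n" by simp
    have "(Q' *\<^sub>v x) $ i = (Q *\<^sub>v x) $ i"
      using Q i nm x(1) by (auto simp: Q'_def scalar_prod_def)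
    then show "(Q *\<^sub>v x) $ i = 0\<^sub>v n $ i" using x(3) i nm by simp
  qed (use Q in auto)
  then show False using inj x by blast
qed

text \<open>The two dimensions are not known to agree beforehand. Preimages of the unit vectors form
  a right inverse \<open>B\<close>, which is itself injective, so the dimension bound applies to
  both \<open>Q\<close> and \<open>B\<close>.\<close>

lemma bijective_mat_GL:
  assumes Q: "Q \<in> carrier_mat n m" and inj: "\<And>x. x \<in> carrier_vec m \<Longrightarrow> Q *\<^sub>v x = 0\<^sub>v n \<Longrightarrow> x = 0\<^sub>v m"
    and surj: "\<And>y. y \<in> carrier_vec n \<Longrightarrow> \<exists>x\<in>carrier_vec m. Q *\<^sub>v x = y"
  shows "n = m \<and> Q \<in> carrier (GL n)"
proof -
  obtain b where b: "\<And>j. b j \<in> carrier_vec m \<and> Q *\<^sub>v b j = unit_vec n j"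
    using surj[of "unit_vec n _"] by (metis unit_vec_carrier)
  define B where "B = mat m n (\<lambda>(i,j). b j $ i)"
  have B: "B \<in> carrier_mat m n" by (simp add: B_def)
  have col: "col B j = b j" if "j < n" for j
    using that b[of j] by (intro eq_vecI) (auto simp: B_def)
  have QB: "Q * B = 1\<^sub>m n"
  proof (rule eq_matI)
    fix i j assume ij: "i < dim_row (1\<^sub>m n)" "j < dim_col (1\<^sub>m n)"
    then have "(Q * B) $$ (i,j) = (Q *\<^sub>v b j) $ i" using Q B col by auto
    then show "(Q * B) $$ (i,j) = 1\<^sub>m n $$ (i,j)" using b ij by auto
  qed (use Q B in auto)
  have "x = 0\<^sub>v n" if "x \<in> carrier_vec n" "B *\<^sub>v x = 0\<^sub>v m" for x
  proof -
    have "x = (Q * B) *\<^sub>v x" using that QB by simp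
    also have "\<dots> = Q *\<^sub>v (B *\<^sub>v x)" using Q B that(1) by simp
    finally show ?thesis using that(2) Q by auto
  qed
  then have "n \<le> m" using injective_mat_dim_le[OF B] by blast
  moreover have "m \<le> n" using injective_mat_dim_le[OF Q inj] by blast
  ultimately have nm: "n = m" by simp
  then have "B * Q = 1\<^sub>m n" using mat_mult_left_right_inverse[of Q n B] Q B QB by simp
  then show ?thesis using nm Q B QB by (auto simp: GL_iff)
qed

section \<open>Isomorphism classes and complete invariants\<close>

lemma rep_iso_sym: "(x, y) \<in> rep_iso G \<Longrightarrow> (y, x) \<in> rep_iso G"
proof -
  assume "(x, y) \<in> rep_iso G"
  then obtain n \<rho> \<sigma> P where xy: "x = (n, \<rho>)" "y = (n, \<sigma>)" "representation G n \<rho>" "representation G n \<sigma>"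
    and P: "P \<in> carrier (GL n)" "\<forall>g\<in>carrier G. P * \<rho> g = \<sigma> g * P" by (auto simp: rep_iso_def)
  obtain Q where Q: "P \<in> carrier_mat n n" "Q \<in> carrier_mat n n" "Q * P = 1\<^sub>m n" "P * Q = 1\<^sub>m n"
    using P(1) by (auto simp: GL_iff)
  have "Q * \<sigma> g = \<rho> g * Q" if g: "g \<in> carrier G" for g
  proof -
    have c: "\<rho> g \<in> carrier_mat n n" "\<sigma> g \<in> carrier_mat n n" using xy(3,4) g by (auto intro: rep_carrier)
    have "Q * \<sigma> g = Q * (\<sigma> g * P) * Q" using Q c by (simp add: assoc_mult_mat[of _ n n _ n _ n])
    also have "\<dots> = Q * (P * \<rho> g) * Q" using P g by simp
    also have "\<dots> = (Q * P) * \<rho> g * Q" using Q(1,2) c by (simp add: assoc_mult_mat[of _ n n _ n _ n])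
    finally show ?thesis using Q c by simp
  qed
  moreover have "Q \<in> carrier (GL n)" using Q by (auto simp: GL_iff)
  ultimately show ?thesis using xy by (auto simp: rep_iso_def)
qed

lemma rep_iso_trans: "(x, y) \<in> rep_iso G \<Longrightarrow> (y, z) \<in> rep_iso G \<Longrightarrow> (x, z) \<in> rep_iso G"
proof -
  assume "(x, y) \<in> rep_iso G" "(y, z) \<in> rep_iso G"
  then obtain n \<rho> \<sigma> \<tau> P R where xyz: "x = (n, \<rho>)" "y = (n, \<sigma>)" "z = (n, \<tau>)"
      "representation G n \<rho>" "representation G n \<sigma>" "representation G n \<tau>"
    and P: "P \<in> carrier (GL n)" "\<forall>g\<in>carrier G. P * \<rho> g = \<sigma> g * P"
    and R: "R \<in> carrier (GL n)" "\<forall>g\<in>carrier G. R * \<sigma> g = \<tau> g * R" by (auto simp: rep_iso_def)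
  have RP: "R * P \<in> carrier (GL n)"
    using monoid.m_closed[OF group.is_monoid[OF group_GL] R(1) P(1)] by (simp add: GL_simps)
  have "R * P * \<rho> g = \<tau> g * (R * P)" if g: "g \<in> carrier G" for g
  proof -
    have c: "\<rho> g \<in> carrier_mat n n" "\<sigma> g \<in> carrier_mat n n" "\<tau> g \<in> carrier_mat n n"
        "P \<in> carrier_mat n n" "R \<in> carrier_mat n n"
      using xyz g P(1) R(1) by (auto simp: GL_iff intro: rep_carrier)
    have "R * P * \<rho> g = R * (\<sigma> g * P)" using P(2) g c by (simp add: assoc_mult_mat[of _ n n _ n _ n])
    also have "\<dots> = R * \<sigma> g * P" using c by (intro assoc_mult_mat[symmetric])
    also have "\<dots> = \<tau> g * R * P" using R(2) g by simp
    also have "\<dots> = \<tau> g * (R * P)" using c by (intro assoc_mult_mat)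
    finally show ?thesis .
  qed
  then show ?thesis using xyz RP by (auto simp: rep_iso_def)
qed

text \<open>A complete invariant \<open>f\<close> on \<open>S\<close> counts the classes. A class
  may contain pairs outside \<open>S\<close>, where \<open>f\<close> says nothing; reflexivity of
  \<open>rep_iso G\<close> at points of \<open>S\<close> comes from the hypothesis itself.\<close>

lemma card_rep_classes:
  assumes f: "\<And>x y. x \<in> S \<Longrightarrow> y \<in> S \<Longrightarrow> (x, y) \<in> rep_iso G \<longleftrightarrow> f x = f y"
  shows "card (S // rep_iso G) = card (f ` S)"
proof -
  have img: "rep_iso G `` {x} = rep_iso G `` {y} \<longleftrightarrow> f x = f y" if x: "x \<in> S" and y: "y \<in> S" for x y
  proof
    assume "rep_iso G `` {x} = rep_iso G `` {y}"
    moreover have "(y, y) \<in> rep_iso G" using f[OF y y] by simp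
    ultimately show "f x = f y" using f[OF x y] by auto
  next
    assume "f x = f y"
    then have "(x, y) \<in> rep_iso G" using f[OF x y] by simp
    then have "(x, z) \<in> rep_iso G \<longleftrightarrow> (y, z) \<in> rep_iso G" for z
      using rep_iso_sym[of x y G] rep_iso_trans[of x y G z] rep_iso_trans[of y x G z] by blast
    then show "rep_iso G `` {x} = rep_iso G `` {y}" by (simp add: set_eq_iff)
  qed
  \<comment> \<open>The invariant of a class is read off at some representative inside
    \<open>S\<close>; the choice is harmless since representatives in \<open>S\<close> share their
    value of \<open>f\<close>.\<close>
  let ?g = "\<lambda>C. f (SOME x. x \<in> S \<and> rep_iso G `` {x} = C)"
  have g: "?g (rep_iso G `` {x}) = f x" if x: "x \<in> S" for x
  proof -
    let ?y = "SOME y. y \<in> S \<and> rep_iso G `` {y} = rep_iso G `` {x}"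
    have "?y \<in> S \<and> rep_iso G `` {?y} = rep_iso G `` {x}"
      by (rule someI[of _ x]) (use x in simp)
    then show ?thesis using img[of ?y x] x by simp
  qed
  have "bij_betw ?g (S // rep_iso G) (f ` S)"
  proof (rule bij_betw_imageI)
    show "inj_on ?g (S // rep_iso G)"
    proof (rule inj_onI)
      fix C D assume "C \<in> S // rep_iso G" "D \<in> S // rep_iso G" and eq: "?g C = ?g D"
      then obtain x y where xy: "x \<in> S" "y \<in> S" "C = rep_iso G `` {x}" "D = rep_iso G `` {y}"
        by (auto simp: quotient_def)
      then have "f x = f y" using eq by (simp only: g)
      then show "C = D" using xy img by simp
    qed
    have "S // rep_iso G = (\<lambda>x. rep_iso G `` {x}) ` S" by (auto simp: quotient_def)
    then show "?g ` (S // rep_iso G) = f ` S"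
      by (simp only: image_image) (rule image_cong[OF refl g])
  qed
  then show ?thesis by (rule bij_betw_same_card)
qed

section \<open>The action of the rotation group on characters of the plane\<close>

definition N0_grp :: "'a::field vec monoid" where
  "N0_grp = \<lparr>carrier = N0, mult = (+), one = 0\<^sub>v 2\<rparr>"

definition H0_grp :: "'a::field mat monoid" where
  "H0_grp = \<lparr>carrier = H0, mult = (*), one = 1\<^sub>m 2\<rparr>"

lemma N0_grp_simps [simp]:
  "carrier N0_grp = N0" "x \<otimes>\<^bsub>N0_grp\<^esub> y = x + y" "\<one>\<^bsub>N0_grp\<^esub> = 0\<^sub>v 2"
  by (simp_all add: N0_grp_def)

lemma H0_grp_simps [simp]:
  "carrier H0_grp = H0" "x \<otimes>\<^bsub>H0_grp\<^esub> y = x * y" "\<one>\<^bsub>H0_grp\<^esub> = 1\<^sub>m 2"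
  by (simp_all add: H0_grp_def)

lemma G0_simps [simp]:
  "carrier G0 = N0 \<times> H0" "(z, h) \<otimes>\<^bsub>G0\<^esub> (z', h') = (z + h *\<^sub>v z', h * h')" "\<one>\<^bsub>G0\<^esub> = (0\<^sub>v 2, 1\<^sub>m 2)"
  by (simp_all add: G0_def)

lemma one_in_H0: "1\<^sub>m 2 \<in> H0"
  unfolding H0_def H0_one by (intro CollectI exI[of _ 1] exI[of _ 0]) simp

lemma H0_mult_vec_closed: "h \<in> H0 \<Longrightarrow> z \<in> N0 \<Longrightarrow> h *\<^sub>v z \<in> N0"
  using H0_carrier[of h] by (simp add: N0_def)

lemma N0_grp_comm_group: "comm_group (N0_grp :: 'a::field vec monoid)"
proof (rule comm_groupI)
  fix x :: "'a vec" assume "x \<in> carrier N0_grp"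
  then show "\<exists>y\<in>carrier N0_grp. y \<otimes>\<^bsub>N0_grp\<^esub> x = \<one>\<^bsub>N0_grp\<^esub>"
    by (intro bexI[of _ "- x"]) (auto simp: N0_def)
qed (auto simp: N0_def intro: comm_add_vec)

lemma H0_grp_comm_group: "comm_group (H0_grp :: 'a::field mat monoid)"
proof (rule comm_groupI)
  fix x y z :: "'a mat" assume xyz: "x \<in> carrier H0_grp" "y \<in> carrier H0_grp" "z \<in> carrier H0_grp"
  then show "x \<otimes>\<^bsub>H0_grp\<^esub> y \<otimes>\<^bsub>H0_grp\<^esub> z = x \<otimes>\<^bsub>H0_grp\<^esub> (y \<otimes>\<^bsub>H0_grp\<^esub> z)"
    using H0_carrier[of x] H0_carrier[of y] H0_carrier[of z] by (simp add: assoc_mult_mat[of _ 2 2 _ 2 _ 2])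
  show "x \<otimes>\<^bsub>H0_grp\<^esub> y = y \<otimes>\<^bsub>H0_grp\<^esub> x"
    using xyz by (auto simp: H0_def H0_mult algebra_simps)
qed (auto simp: one_in_H0 H0_mult_closed H0_inv dest: H0_carrier)

lemma group_N0_grp: "group (N0_grp :: 'a::field vec monoid)"
  and group_H0_grp: "group (H0_grp :: 'a::field mat monoid)"
  using N0_grp_comm_group H0_grp_comm_group by (auto intro: comm_group.axioms)

lemma bij_betw_N0: "bij_betw (\<lambda>(x, y). vec 2 (\<lambda>i. if i = 0 then x else y)) UNIV (N0 :: 'a::field vec set)"
proof (rule bij_betw_byWitness[of _ "\<lambda>v. (v $ 0, v $ 1)"])
  show "\<forall>v\<in>N0. (\<lambda>(x, y). vec 2 (\<lambda>i. if i = 0 then x else y)) (v $ 0, v $ 1 :: 'a) = v"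
    by (auto simp: N0_def less_2_cases_iff intro!: eq_vecI)
qed (auto simp: N0_def)

lemma card_N0: "card (N0 :: 'a::{field,finite} vec set) = CARD('a)\<^sup>2"
  using bij_betw_same_card[OF bij_betw_N0[where 'a = 'a]]
  by (simp add: card_cartesian_product power2_eq_square flip: UNIV_Times_UNIV)

lemma finite_N0: "finite (N0 :: 'a::{field,finite} vec set)"
  using bij_betw_finite[OF bij_betw_N0[where 'a = 'a]] by simp

lemma finite_H0: "finite (H0 :: 'a::{field,finite} mat set)"
proof (rule finite_subset)
  show "H0 \<subseteq> range (\<lambda>(a::'a, b). mat_of_rows_list 2 [[a, - b], [b, a]])" by (auto simp: H0_def)
qed simp

text \<open>Translation by 1 permutes the field, so comparing sums over all elements gives
  \<open>of_nat (CARD('a)) = 0\<close>. With 2 = 0 an odd cardinality would map to 1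
  instead.\<close>

lemma two_neq_zero:
  assumes "odd (CARD('a::{field,finite}))"
  shows "(2::'a) \<noteq> 0"
proof
  assume 2: "(2::'a) = 0"
  have "(\<Sum>x\<in>UNIV. x) = (\<Sum>x\<in>UNIV. x + 1 :: 'a)"
    by (rule sum.reindex_bij_witness[of _ "\<lambda>x. x + 1" "\<lambda>x. x - 1"]) auto
  then have "of_nat (CARD('a)) = (0::'a)" by (simp add: sum.distrib)
  moreover obtain k where "CARD('a) = 2 * k + 1" using assms by (elim oddE)
  ultimately show False using 2 by simp
qed

text \<open>The determinant of \<open>h - 1\<close> is
  \<open>(a - 1)\<^sup>2 + b\<^sup>2 = 2 * (1 - a)\<close>, nonzero for
  \<open>h \<noteq> 1\<^sub>m 2\<close>. Multiplying the fixed-point equations by the adjugate shows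
  that both coordinates of \<open>z\<close> vanish.\<close>

lemma H0_fixed_point_free:
  assumes two: "(2::'a::field) \<noteq> 0" and h: "h \<in> H0" "h \<noteq> 1\<^sub>m 2" and z: "z \<in> N0" "h *\<^sub>v z = (z :: 'a vec)"
  shows "z = 0\<^sub>v 2"
proof -
  obtain a b where ab: "h = mat_of_rows_list 2 [[a, - b], [b, a]]" "a\<^sup>2 + b\<^sup>2 = 1" using h by (auto simp: H0_def)
  have z2: "dim_vec z = 2" using z by (simp add: N0_def carrier_vecD)
  have "(h *\<^sub>v z) $ 0 = a * z $ 0 - b * z $ 1" "(h *\<^sub>v z) $ 1 = b * z $ 0 + a * z $ 1"
    using z2 by (simp_all add: ab mat_of_rows_list_def scalar_prod_def numeral_2_eq_2)
  then have e: "a * z $ 0 - b * z $ 1 = z $ 0" "b * z $ 0 + a * z $ 1 = z $ 1" using z(2) by auto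
  define x y where "x = z $ 0" and "y = z $ 1"
  have e: "(a - 1) * x = b * y" "(a - 1) * y = - (b * x)" using e by (simp_all add: x_def y_def algebra_simps)
  have d: "(a - 1)\<^sup>2 + b\<^sup>2 = 2 * (1 - a)" using ab(2) by (simp add: power2_eq_square algebra_simps)
  have "a \<noteq> 1"
  proof
    assume "a = 1"
    then have "b = 0" using ab(2) by simp
    then show False using h(2) ab(1) \<open>a = 1\<close> H0_one by metis
  qed
  then have dnz: "(a - 1)\<^sup>2 + b\<^sup>2 \<noteq> 0" using two unfolding d by simp
  have "((a - 1)\<^sup>2 + b\<^sup>2) * x = (a - 1) * ((a - 1) * x) + b * (b * x)"
    by (simp add: power2_eq_square algebra_simps)
  also have "\<dots> = b * ((a - 1) * y) + b * (b * x)" unfolding e(1) by (simp add: algebra_simps)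
  also have "\<dots> = 0" unfolding e(2) by simp
  finally have "x = 0" using dnz by simp
  have "((a - 1)\<^sup>2 + b\<^sup>2) * y = (a - 1) * ((a - 1) * y) + b * (b * y)"
    by (simp add: power2_eq_square algebra_simps)
  also have "\<dots> = 0" unfolding e(2) using \<open>x = 0\<close> e(1) by simp
  finally have "y = 0" using dnz by simp
  show ?thesis using \<open>x = 0\<close> \<open>y = 0\<close> z2 by (intro eq_vecI) (auto simp: x_def y_def less_2_cases_iff)
qed

abbreviation triv_N0 :: "'a::field vec \<Rightarrow> complex" where
  "triv_N0 \<equiv> restrict (\<lambda>_. 1) N0"

text \<open>Precomposition is a right action, so composition reverses the order and the weights of
  translates below involve \<open>hinv h\<close>.\<close>

definition act :: "'a::field mat \<Rightarrow> ('a vec \<Rightarrow> complex) \<Rightarrow> 'a vec \<Rightarrow> complex" where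
  "act h \<chi> = restrict (\<lambda>z. \<chi> (h *\<^sub>v z)) N0"

lemma act_apply [simp]: "z \<in> N0 \<Longrightarrow> act h \<chi> z = \<chi> (h *\<^sub>v z)"
  by (simp add: act_def)

abbreviation "N0_chars \<equiv> chars N0_grp"

lemma N0_char_add: "\<chi> \<in> N0_chars \<Longrightarrow> z \<in> N0 \<Longrightarrow> w \<in> N0 \<Longrightarrow> \<chi> (z + w) = \<chi> z * \<chi> w"
  using chars_mult[of \<chi> N0_grp z w] by simp

lemma N0_char_zero: "\<chi> \<in> N0_chars \<Longrightarrow> \<chi> (0\<^sub>v 2) = 1"
  using chars_one[of \<chi> N0_grp] by simp

lemma N0_chars_eqI: "\<chi> \<in> N0_chars \<Longrightarrow> \<chi>' \<in> N0_chars \<Longrightarrow> (\<And>x. x \<in> N0 \<Longrightarrow> \<chi> x = \<chi>' x) \<Longrightarrow> \<chi> = \<chi>'"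
  using chars_eqI[of \<chi> N0_grp \<chi>'] by simp

lemma triv_N0_chars: "triv_N0 \<in> N0_chars"
  using group.trivial_char[OF group_N0_grp] by simp

lemma act_chars:
  fixes \<chi> :: "'a::field vec \<Rightarrow> complex"
  assumes "\<chi> \<in> N0_chars" "h \<in> H0"
  shows "act h \<chi> \<in> N0_chars"
proof -
  have h: "h \<in> carrier_mat 2 2" using assms(2) by (rule H0_carrier)
  have "restrict (\<lambda>z. \<chi> (h *\<^sub>v z)) (carrier N0_grp) \<in> N0_chars"
  proof (rule charsI)
    show "monoid (N0_grp :: 'a vec monoid)" using group_N0_grp by (rule group.is_monoid)
    have "h *\<^sub>v 0\<^sub>v 2 = 0\<^sub>v 2" using h by auto
    then show "\<chi> (h *\<^sub>v \<one>\<^bsub>N0_grp\<^esub>) = 1" using assms by (simp add: N0_char_zero)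
    fix x y :: "'a vec" assume xy: "x \<in> carrier N0_grp" "y \<in> carrier N0_grp"
    then have "h *\<^sub>v (x + y) = h *\<^sub>v x + h *\<^sub>v y"
      using h by (auto simp: N0_def intro!: mult_add_distrib_mat_vec)
    then show "\<chi> (h *\<^sub>v (x \<otimes>\<^bsub>N0_grp\<^esub> y)) = \<chi> (h *\<^sub>v x) * \<chi> (h *\<^sub>v y)"
      using xy assms by (simp add: N0_char_add H0_mult_vec_closed)
  qed
  then show ?thesis by (simp add: act_def)
qed

lemma act_act:
  assumes "h \<in> H0" "h' \<in> H0"
  shows "act h (act h' \<chi>) = act (h' * h) \<chi>"
proof
  fix z :: "'a vec"
  show "act h (act h' \<chi>) z = act (h' * h) \<chi> z"
    using assms H0_carrier[of h] H0_carrier[of h'] H0_mult_vec_closed[of h z]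
    by (cases "z \<in> N0") (auto simp: act_def N0_def assoc_mult_mat_vec[of _ 2 2 _ 2])
qed

lemma act_one: "\<chi> \<in> N0_chars \<Longrightarrow> act (1\<^sub>m 2) \<chi> = \<chi>"
  using act_chars[OF _ one_in_H0, of \<chi>] by (rule N0_chars_eqI) (auto simp: N0_def)

lemma act_triv: "h \<in> H0 \<Longrightarrow> act h triv_N0 = triv_N0"
  by (auto simp: act_def H0_mult_vec_closed)

abbreviation "hinv h \<equiv> inv\<^bsub>H0_grp\<^esub> h"

lemma hinv:
  assumes "h \<in> H0"
  shows "hinv h \<in> H0" "hinv h * h = 1\<^sub>m 2" "h * hinv h = 1\<^sub>m 2" "hinv (hinv h) = h"
proof -
  interpret comm_group "H0_grp :: 'a mat monoid" by (rule H0_grp_comm_group)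
  show "hinv h \<in> H0" "hinv h * h = 1\<^sub>m 2" "h * hinv h = 1\<^sub>m 2" "hinv (hinv h) = h"
    using assms inv_closed[of h] l_inv[of h] r_inv[of h] inv_inv[of h] by simp_all
qed

lemma hinv_mult: "h \<in> H0 \<Longrightarrow> k \<in> H0 \<Longrightarrow> hinv (h * k) = hinv h * hinv k"
  using comm_group.inv_mult[OF H0_grp_comm_group, of h k] by simp

lemma H0_comm: "h \<in> H0 \<Longrightarrow> k \<in> H0 \<Longrightarrow> h * k = k * h"
  using comm_monoid.m_comm[OF comm_group.axioms(1)[OF H0_grp_comm_group], of h k] by simp

lemma H0_assoc: "h \<in> H0 \<Longrightarrow> k \<in> H0 \<Longrightarrow> l \<in> H0 \<Longrightarrow> h * k * l = h * (k * l)"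
  using H0_carrier[of h] H0_carrier[of k] H0_carrier[of l] by (simp add: assoc_mult_mat[of _ 2 2 _ 2 _ 2])

lemma H0_mult_vec_assoc: "h \<in> H0 \<Longrightarrow> k \<in> H0 \<Longrightarrow> z \<in> N0 \<Longrightarrow> h * k *\<^sub>v z = h *\<^sub>v (k *\<^sub>v z)"
  using H0_carrier[of h] H0_carrier[of k] by (simp add: N0_def assoc_mult_mat_vec[of _ 2 2 _ 2])

text \<open>For \<open>h \<noteq> 1\<^sub>m 2\<close> the map \<open>h - 1\<close> is injective on
  the finite set \<open>N0\<close>, hence surjective. A character fixed by \<open>h\<close> is
  trivial on its image, so everywhere.\<close>

lemma act_stabilizer:
  assumes two: "(2::'a::{field,finite}) \<noteq> 0" and \<chi>: "\<chi> \<in> N0_chars" "\<chi> \<noteq> triv_N0"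
    and h: "h \<in> H0" and eq: "act h \<chi> = (\<chi> :: 'a vec \<Rightarrow> complex)"
  shows "h = 1\<^sub>m 2"
proof (rule ccontr)
  assume h1: "h \<noteq> 1\<^sub>m 2"
  have hc: "h \<in> carrier_mat 2 2" using h by (rule H0_carrier)
  let ?f = "\<lambda>z. h *\<^sub>v z - z"
  have f: "?f z \<in> N0" if "z \<in> N0" for z using that hc by (simp add: N0_def)
  have "inj_on ?f N0"
  proof (rule inj_onI)
    fix z w assume zw: "z \<in> N0" "w \<in> N0" "?f z = ?f w"
    then have c: "z \<in> carrier_vec 2" "w \<in> carrier_vec 2" by (auto simp: N0_def)
    have "h *\<^sub>v (z - w) = h *\<^sub>v z - h *\<^sub>v w" using hc c by (simp add: mult_minus_distrib_mat_vec)
    also have "\<dots> = z - w"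
    proof (rule eq_vecI)
      fix i assume "i < dim_vec (z - w)"
      then have i: "i < 2" using c by simp
      have "?f z $ i = ?f w $ i" using zw(3) by simp
      then show "(h *\<^sub>v z - h *\<^sub>v w) $ i = (z - w) $ i" using i c hc by (simp add: algebra_simps)
    qed (use c hc in simp)
    finally have "z - w = 0\<^sub>v 2"
      using H0_fixed_point_free[OF two h h1, of "z - w"] c by (simp add: N0_def)
    then have "(z - w) $ i = 0" if "i < 2" for i using that by simp
    then show "z = w" using c by (intro eq_vecI) auto
  qed
  then have surj: "?f ` N0 = N0" using f endo_inj_surj[OF finite_N0, of ?f] by blast
  have "\<chi> (?f z) = 1" if z: "z \<in> N0" for z
  proof -
    have "\<chi> z = \<chi> (h *\<^sub>v z)" using act_apply[OF z, of h \<chi>] eq by simp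
    also have "h *\<^sub>v z = ?f z + z" using z hc by (intro eq_vecI) (auto simp: N0_def)
    also have "\<chi> (?f z + z) = \<chi> (?f z) * \<chi> z" using \<chi>(1) f[OF z] z by (rule N0_char_add)
    finally show ?thesis
      using group.chars_nonzero[OF group_N0_grp \<chi>(1)] z by simp
  qed
  then have "\<chi> z = 1" if "z \<in> N0" for z using surj that by (metis (no_types, lifting) imageE)
  then have "\<chi> = triv_N0" using \<chi>(1) triv_N0_chars by (intro N0_chars_eqI) auto
  then show False using \<chi>(2) by simp
qed

text \<open>Freeness in the form used for counting: the orbit of a nontrivial character has as many
  elements as \<open>H0\<close>.\<close>

lemma act_inj:
  assumes two: "(2::'a::{field,finite}) \<noteq> 0" and \<chi>: "\<chi> \<in> N0_chars" "\<chi> \<noteq> triv_N0"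
  shows "inj_on (\<lambda>h. act h \<chi>) (H0 :: 'a mat set)"
proof (rule inj_onI)
  fix h k :: "'a mat" assume hk: "h \<in> H0" "k \<in> H0" "act h \<chi> = act k \<chi>"
  then have "act (h * hinv k) \<chi> = act (hinv k) (act k \<chi>)" by (simp add: hinv act_act[symmetric])
  also have "\<dots> = \<chi>" using hk \<chi> by (simp add: hinv act_act act_one)
  finally have "h * hinv k = 1\<^sub>m 2" using act_stabilizer[OF two \<chi>] hk by (simp add: hinv H0_mult_closed)
  then have "h * (hinv k * k) = 1\<^sub>m 2 * k" using H0_assoc[OF hk(1) hinv(1)[OF hk(2)] hk(2)] by simp
  then show "h = k"
    using right_mult_one_mat[OF H0_carrier[OF hk(1)]] left_mult_one_mat[OF H0_carrier[OF hk(2)]] hk(2)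
    by (simp add: hinv)
qed

section \<open>Weight vectors and induced representations\<close>

lemma rep_N0:
  assumes "representation G0 n \<rho>"
  shows "representation N0_grp n (\<lambda>z. \<rho> (z, 1\<^sub>m 2))"
proof (rule representationI)
  show "group (N0_grp :: 'a vec monoid)" by (rule group_N0_grp)
  show "\<rho> (\<one>\<^bsub>N0_grp\<^esub>, 1\<^sub>m 2) = 1\<^sub>m n" using rep_one[OF assms group_G0] by simp
  fix g h :: "'a vec" assume gh: "g \<in> carrier N0_grp" "h \<in> carrier N0_grp"
  then show "\<rho> (g, 1\<^sub>m 2) \<in> carrier_mat n n" using rep_carrier[OF assms, of "(g, 1\<^sub>m 2)"] by (simp add: one_in_H0)
  show "\<rho> (g \<otimes>\<^bsub>N0_grp\<^esub> h, 1\<^sub>m 2) = \<rho> (g, 1\<^sub>m 2) * \<rho> (h, 1\<^sub>m 2)"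
    using gh rep_mult[OF assms, of "(g, 1\<^sub>m 2)" "(h, 1\<^sub>m 2)"] by (simp add: one_in_H0) (simp add: N0_def)
qed

lemma rep_H0:
  assumes "representation G0 n \<rho>"
  shows "representation H0_grp n (\<lambda>h. \<rho> (0\<^sub>v 2, h))"
proof (rule representationI)
  show "group (H0_grp :: 'a mat monoid)" by (rule group_H0_grp)
  show "\<rho> (0\<^sub>v 2, \<one>\<^bsub>H0_grp\<^esub>) = 1\<^sub>m n" using rep_one[OF assms group_G0] by simp
  fix g h :: "'a mat" assume gh: "g \<in> carrier H0_grp" "h \<in> carrier H0_grp"
  have 0: "0\<^sub>v 2 \<in> N0" by (simp add: N0_def)
  then show "\<rho> (0\<^sub>v 2, g) \<in> carrier_mat n n" using gh rep_carrier[OF assms, of "(0\<^sub>v 2, g)"] by simp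
  have "g *\<^sub>v 0\<^sub>v 2 = 0\<^sub>v 2" using gh H0_carrier[of g] by auto
  then show "\<rho> (0\<^sub>v 2, g \<otimes>\<^bsub>H0_grp\<^esub> h) = \<rho> (0\<^sub>v 2, g) * \<rho> (0\<^sub>v 2, h)"
    using gh 0 rep_mult[OF assms, of "(0\<^sub>v 2, g)" "(0\<^sub>v 2, h)"] by simp
qed

text \<open>The zero vector has every weight, so that the components of a decomposition qualify
  without a case distinction; being nonzero is demanded separately where it matters.\<close>

definition weight_vec :: "nat \<Rightarrow> ('a::field vec \<times> 'a mat \<Rightarrow> complex mat) \<Rightarrow> ('a vec \<Rightarrow> complex) \<Rightarrow> complex vec \<Rightarrow> bool" where
  "weight_vec n \<rho> \<chi> v \<longleftrightarrow> v \<in> carrier_vec n \<and> (\<forall>z\<in>N0. \<rho> (z, 1\<^sub>m 2) *\<^sub>v v = \<chi> z \<cdot>\<^sub>v v)"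

lemma rep_factor:
  assumes "representation G0 n \<rho>" "z \<in> N0" "h \<in> H0"
  shows "\<rho> (z, h) = \<rho> (z, 1\<^sub>m 2) * \<rho> (0\<^sub>v 2, h)"
  using rep_mult[OF assms(1), of "(z, 1\<^sub>m 2)" "(0\<^sub>v 2, h)"] assms H0_carrier[of h]
  by (simp add: N0_def one_in_H0)

text \<open>This is the identity \<open>(z, 1)(0, h) = (z, h) = (0, h)(hinv h z, 1)\<close> in
  \<open>G0\<close>, applied to \<open>v\<close>.\<close>

lemma weight_vec_translate:
  assumes rep: "representation G0 n \<rho>" and h: "h \<in> H0" and v: "weight_vec n \<rho> \<chi> v"
  shows "weight_vec n \<rho> (act (hinv h) \<chi>) (\<rho> (0\<^sub>v 2, h) *\<^sub>v v)"
  unfolding weight_vec_def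
proof (intro conjI ballI)
  have vc: "v \<in> carrier_vec n" using v by (simp add: weight_vec_def)
  have 0: "0\<^sub>v 2 \<in> N0" by (simp add: N0_def)
  have hc: "h \<in> carrier_mat 2 2" using h by (rule H0_carrier)
  have \<rho>h: "\<rho> (0\<^sub>v 2, h) \<in> carrier_mat n n" using rep_carrier[OF rep, of "(0\<^sub>v 2, h)"] h 0 by simp
  then show "\<rho> (0\<^sub>v 2, h) *\<^sub>v v \<in> carrier_vec n" using vc by simp
  fix z :: "'a vec" assume z: "z \<in> N0"
  let ?w = "hinv h *\<^sub>v z"
  have w: "?w \<in> N0" using h z by (simp add: hinv H0_mult_vec_closed)
  have hw: "h *\<^sub>v ?w = z" using h z by (simp add: hinv H0_mult_vec_assoc[symmetric]) (simp add: N0_def)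
  have "\<rho> (z, 1\<^sub>m 2) *\<^sub>v (\<rho> (0\<^sub>v 2, h) *\<^sub>v v) = \<rho> (z, h) *\<^sub>v v"
    using rep_mult_vec[OF rep, of "(z, 1\<^sub>m 2)" "(0\<^sub>v 2, h)"] z h 0 vc hc by (simp add: one_in_H0) (simp add: N0_def)
  also have "\<dots> = \<rho> (0\<^sub>v 2, h) *\<^sub>v (\<rho> (?w, 1\<^sub>m 2) *\<^sub>v v)"
    using rep_mult_vec[OF rep, of "(0\<^sub>v 2, h)" "(?w, 1\<^sub>m 2)"] w h 0 vc hc hw z by (simp add: one_in_H0) (simp add: N0_def)
  also have "\<dots> = \<chi> ?w \<cdot>\<^sub>v (\<rho> (0\<^sub>v 2, h) *\<^sub>v v)"
    using v w \<rho>h by (simp add: weight_vec_def mult_mat_vec)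
  finally show "\<rho> (z, 1\<^sub>m 2) *\<^sub>v (\<rho> (0\<^sub>v 2, h) *\<^sub>v v) = act (hinv h) \<chi> z \<cdot>\<^sub>v (\<rho> (0\<^sub>v 2, h) *\<^sub>v v)"
    using z by simp
qed

lemma mat_eq_one:
  fixes A :: "'a::comm_semiring_1 mat"
  assumes A: "A \<in> carrier_mat n n" "\<And>v. v \<in> carrier_vec n \<Longrightarrow> A *\<^sub>v v = v"
  shows "A = 1\<^sub>m n"
proof (rule eq_matI)
  fix i j assume ij: "i < dim_row (1\<^sub>m n :: 'a mat)" "j < dim_col (1\<^sub>m n :: 'a mat)"
  then have "A $$ (i, j) = (A *\<^sub>v unit_vec n j) $ i"
    using A(1) scalar_prod_right_unit[of j n "row A i"] by auto
  then show "A $$ (i, j) = 1\<^sub>m n $$ (i, j)" using A(2)[of "unit_vec n j"] ij by auto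
qed (use A in auto)

text \<open>If every nontrivial weight component of every vector vanished, each vector would equal
  its trivial component, so \<open>N0\<close> would act as the identity and the representation would
  be of type I.\<close>

lemma type_II_weight:
  fixes \<rho> :: "'a::{field,finite} vec \<times> 'a mat \<Rightarrow> complex mat"
  assumes "type_II n \<rho>"
  shows "\<exists>\<chi>\<in>N0_chars. \<chi> \<noteq> triv_N0 \<and> (\<exists>v. v \<noteq> 0\<^sub>v n \<and> weight_vec n \<rho> \<chi> v)"
proof (rule ccontr)
  assume none: "\<not> ?thesis"
  have rep: "representation G0 n \<rho>" using assms by (simp add: type_II_def)
  have "\<rho> (z, 1\<^sub>m 2) *\<^sub>v v = v" if v: "v \<in> carrier_vec n" and z: "z \<in> N0" for v z
  proof -
    have "finite (carrier (N0_grp :: 'a vec monoid))" by (simp add: finite_N0)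
    from comm_group.rep_char_decomposition[OF N0_grp_comm_group this rep_N0[OF rep] v]
    obtain u where u: "\<forall>\<chi>\<in>N0_chars. weight_vec n \<rho> \<chi> (u \<chi>)" "v = vsum n N0_chars u"
      unfolding weight_vec_def N0_grp_simps by blast
    have "\<rho> (z, 1\<^sub>m 2) *\<^sub>v u \<chi> = u \<chi>" if \<chi>: "\<chi> \<in> N0_chars" for \<chi>
    proof (cases "\<chi> = triv_N0")
      case True
      then show ?thesis using u(1) \<chi> z by (auto simp: weight_vec_def)
    next
      case False
      then have "u \<chi> = 0\<^sub>v n" using none u(1) \<chi> by blast
      moreover have "\<rho> (z, 1\<^sub>m 2) \<in> carrier_mat n n"
        using rep_carrier[OF rep, of "(z, 1\<^sub>m 2)"] z by (simp add: one_in_H0)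
      ultimately show ?thesis by auto
    qed
    moreover have "\<rho> (z, 1\<^sub>m 2) \<in> carrier_mat n n"
      using rep_carrier[OF rep, of "(z, 1\<^sub>m 2)"] z by (simp add: one_in_H0)
    ultimately show ?thesis
      unfolding u(2) using u(1) by (subst mult_mat_vsum[of _ n n]) (auto simp: vsum_def weight_vec_def)
  qed
  then have "\<rho> (z, 1\<^sub>m 2) = 1\<^sub>m n" if z: "z \<in> N0" for z
    using z rep_carrier[OF rep, of "(z, 1\<^sub>m 2)"]
    by (intro mat_eq_one) (auto simp: one_in_H0)
  then show False using assms by (simp add: type_II_def type_I_def)
qed

section \<open>The representation induced from a character of the plane\<close>

text \<open>Matrix indices are numbers, so the basis labelled by \<open>H0\<close> needs a
  numbering; any bijection serves.\<close>

definition h_enum :: "nat \<Rightarrow> 'a::field mat" where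
  "h_enum = (SOME e. bij_betw e {0..<card (H0 :: 'a mat set)} H0)"

lemma bij_betw_h_enum: "bij_betw h_enum {0..<card (H0 :: 'a::{field,finite} mat set)} (H0 :: 'a mat set)"
  unfolding h_enum_def using someI_ex[OF ex_bij_betw_nat_finite[OF finite_H0[where 'a = 'a]]] .

lemma h_enum_in_H0: "i < card (H0 :: 'a mat set) \<Longrightarrow> (h_enum i :: 'a::{field,finite} mat) \<in> H0"
  using bij_betw_h_enum[where 'a = 'a] by (auto simp: bij_betw_def)

lemma h_enum_inj:
  "i < card (H0 :: 'a mat set) \<Longrightarrow> j < card (H0 :: 'a mat set) \<Longrightarrow>
    h_enum i = (h_enum j :: 'a::{field,finite} mat) \<longleftrightarrow> i = j"
  using bij_betw_h_enum[where 'a = 'a] by (auto simp: bij_betw_def inj_on_def)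

lemma h_enum_surj:
  assumes "(h :: 'a::{field,finite} mat) \<in> H0"
  obtains k where "k < card (H0 :: 'a mat set)" "h_enum k = h"
proof -
  have "h \<in> h_enum ` {0..<card (H0 :: 'a mat set)}"
    using bij_betw_imp_surj_on[OF bij_betw_h_enum[where 'a = 'a]] assms by simp
  then show ?thesis using that by auto
qed

lemma card_H0_pos: "card (H0 :: 'a::{field,finite} mat set) > 0"
  using one_in_H0 finite_H0 by (auto simp: card_gt_0_iff)

text \<open>The basis vector with index \<open>j\<close> has weight \<open>z \<mapsto> \<chi> (h\<^sup>-\<^sup>1 z)\<close> with \<open>h = h_enum j\<close>.\<close>

definition induced :: "('a::field vec \<Rightarrow> complex) \<Rightarrow> 'a vec \<times> 'a mat \<Rightarrow> complex mat" where
  "induced \<chi> = (\<lambda>(z, h). mat (card (H0 :: 'a mat set)) (card (H0 :: 'a mat set))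
     (\<lambda>(i, j). if h_enum i = h * h_enum j then \<chi> (hinv (h_enum i) *\<^sub>v z) else 0))"

lemma induced_carrier:
  "induced (\<chi> :: 'a::field vec \<Rightarrow> complex) g \<in> carrier_mat (card (H0 :: 'a mat set)) (card (H0 :: 'a mat set))"
  by (auto simp: induced_def split: prod.split)

lemma induced_entry:
  assumes "i < card (H0 :: 'a mat set)" "j < card (H0 :: 'a mat set)"
  shows "induced \<chi> (z :: 'a::field vec, h) $$ (i, j) =
    (if h_enum i = h * h_enum j then \<chi> (hinv (h_enum i) *\<^sub>v z) else 0)"
  using assms by (simp add: induced_def)

lemma N0_zero: "0\<^sub>v 2 \<in> N0"
  by (simp add: N0_def)

text \<open>With \<open>h_enum i = h * h_enum k\<close>, the inverse of \<open>h_enum i\<close>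
  sends \<open>z + h *\<^sub>v z'\<close> to
  \<open>hinv (h_enum i) *\<^sub>v z + hinv (h_enum k) *\<^sub>v z'\<close>; the character turns
  this sum into the product of the matrix entries.\<close>

lemma induced_rep:
  fixes \<chi> :: "'a::{field,finite} vec \<Rightarrow> complex"
  assumes \<chi>: "\<chi> \<in> N0_chars"
  shows "representation G0 (card (H0 :: 'a mat set)) (induced \<chi>)"
proof (rule representationI)
  let ?m = "card (H0 :: 'a mat set)"
  show "group (G0 :: ('a vec \<times> 'a mat) monoid)" by (rule group_G0)
  show "induced \<chi> g \<in> carrier_mat ?m ?m" for g by (rule induced_carrier)
  show "induced \<chi> \<one>\<^bsub>G0\<^esub> = 1\<^sub>m ?m"
  proof (rule eq_matI)
    fix i j assume "i < dim_row (1\<^sub>m ?m :: complex mat)" "j < dim_col (1\<^sub>m ?m :: complex mat)"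
    then have ij: "i < ?m" "j < ?m" by auto
    then have H: "(h_enum i :: 'a mat) \<in> H0" "(h_enum j :: 'a mat) \<in> H0" by (auto intro: h_enum_in_H0)
    have "hinv (h_enum i) *\<^sub>v 0\<^sub>v 2 = (0\<^sub>v 2 :: 'a vec)"
      using H0_carrier[OF hinv(1)[OF H(1)]] by auto
    moreover have "1\<^sub>m 2 * h_enum j = (h_enum j :: 'a mat)" using H0_carrier[OF H(2)] by simp
    ultimately show "induced \<chi> \<one>\<^bsub>G0\<^esub> $$ (i, j) = 1\<^sub>m ?m $$ (i, j)"
      using ij \<chi> by (cases "i = j") (simp_all add: induced_entry h_enum_inj N0_char_zero)
  qed (use induced_carrier[of \<chi>] in auto)
  fix g g' :: "'a vec \<times> 'a mat" assume "g \<in> carrier G0" "g' \<in> carrier G0"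
  then obtain z h z' h' where g: "g = (z, h)" "g' = (z', h')" "z \<in> N0" "z' \<in> N0" "h \<in> H0" "h' \<in> H0"
    by (cases g; cases g') auto
  show "induced \<chi> (g \<otimes>\<^bsub>G0\<^esub> g') = induced \<chi> g * induced \<chi> g'"
  proof (rule eq_matI)
    fix i j assume "i < dim_row (induced \<chi> g * induced \<chi> g')" "j < dim_col (induced \<chi> g * induced \<chi> g')"
    then have ij: "i < ?m" "j < ?m"
      using carrier_matD[OF induced_carrier[of \<chi> g]] carrier_matD[OF induced_carrier[of \<chi> g']] by simp_all
    then have H: "(h_enum i :: 'a mat) \<in> H0" "(h_enum j :: 'a mat) \<in> H0" by (auto intro: h_enum_in_H0)
    obtain k where k: "k < ?m" "h_enum k = h' * h_enum j"
      using h_enum_surj[OF H0_mult_closed[OF g(6) H(2)]] by blast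
    have Hk: "(h_enum k :: 'a mat) \<in> H0" using k(1) by (rule h_enum_in_H0)
    have "(induced \<chi> g * induced \<chi> g') $$ (i, j) = (\<Sum>l\<in>{0..<?m}. induced \<chi> g $$ (i, l) * induced \<chi> g' $$ (l, j))"
      using ij induced_carrier[of \<chi> g] induced_carrier[of \<chi> g'] by (auto simp: scalar_prod_def)
    \<comment> \<open>The matrices are monomial: column \<open>j\<close> of
      \<open>induced \<chi> g'\<close> is nonzero only in the row \<open>k\<close> with
      \<open>h_enum k = h' * h_enum j\<close>.\<close>
    also have "\<dots> = (\<Sum>l\<in>{0..<?m}. if l = k then induced \<chi> g $$ (i, l) * \<chi> (hinv (h_enum k) *\<^sub>v z') else 0)"
      by (rule sum.cong) (use ij k in \<open>auto simp: g induced_entry h_enum_inj simp flip: k(2)\<close>)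
    also have "\<dots> = induced \<chi> g $$ (i, k) * \<chi> (hinv (h_enum k) *\<^sub>v z')" using k by simp
    also have "\<dots> = induced \<chi> (g \<otimes>\<^bsub>G0\<^esub> g') $$ (i, j)"
    proof (cases "h_enum i = h * h_enum k")
      case True
      then have "hinv (h_enum i) * h = hinv (h_enum k) * (hinv h * h)"
        using g Hk H by (simp add: hinv_mult H0_assoc hinv H0_comm[of "hinv h"])
      also have "\<dots> = hinv (h_enum k)"
        using g Hk H0_carrier[OF hinv(1)[OF Hk]] by (simp add: hinv)
      finally have e: "hinv (h_enum i) * h = hinv (h_enum k)" .
      have c: "hinv (h_enum i :: 'a mat) \<in> carrier_mat 2 2" "z \<in> carrier_vec 2" "h *\<^sub>v z' \<in> carrier_vec 2"
        using H0_carrier[OF hinv(1)[OF H(1)]] g H0_mult_vec_closed[of h z'] by (auto simp: N0_def)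
      have "hinv (h_enum i) *\<^sub>v (z + h *\<^sub>v z') = hinv (h_enum i) *\<^sub>v z + hinv (h_enum k) *\<^sub>v z'"
        using g H by (simp add: mult_add_distrib_mat_vec[OF c] hinv H0_mult_vec_assoc[symmetric] e)
      then have "\<chi> (hinv (h_enum i) *\<^sub>v (z + h *\<^sub>v z')) = \<chi> (hinv (h_enum i) *\<^sub>v z) * \<chi> (hinv (h_enum k) *\<^sub>v z')"
        using g H Hk \<chi> by (simp add: N0_char_add hinv H0_mult_vec_closed)
      then show ?thesis using True ij k g H by (simp add: induced_entry H0_assoc)
    next
      case False
      then show ?thesis using ij k g H by (simp add: induced_entry H0_assoc)
    qed
    finally show "induced \<chi> (g \<otimes>\<^bsub>G0\<^esub> g') $$ (i, j) = (induced \<chi> g * induced \<chi> g') $$ (i, j)" by simp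
  qed (use carrier_matD[OF induced_carrier[of \<chi>]] in simp_all)
qed

section \<open>The intertwiner defined by a weight vector\<close>

text \<open>The columns are the \<open>H0\<close>-translates of \<open>v\<close>. This is the map
  from the induced representation that sends basis vector \<open>j\<close> to the translate of
  \<open>v\<close> by \<open>h_enum j\<close>.\<close>

definition orbit_mat :: "nat \<Rightarrow> ('a::field vec \<times> 'a mat \<Rightarrow> complex mat) \<Rightarrow> complex vec \<Rightarrow> complex mat" where
  "orbit_mat n \<rho> v = mat n (card (H0 :: 'a mat set)) (\<lambda>(i, j). (\<rho> (0\<^sub>v 2, h_enum j) *\<^sub>v v) $ i)"

lemma orbit_mat_carrier:
  "orbit_mat n (\<rho> :: 'a::field vec \<times> 'a mat \<Rightarrow> complex mat) v \<in> carrier_mat n (card (H0 :: 'a mat set))"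
  by (simp add: orbit_mat_def)

lemma rep_vec_carrier:
  "representation G0 n \<rho> \<Longrightarrow> v \<in> carrier_vec n \<Longrightarrow> z \<in> N0 \<Longrightarrow> h \<in> H0 \<Longrightarrow> \<rho> (z, h) *\<^sub>v v \<in> carrier_vec n"
  using rep_carrier[of G0 n \<rho> "(z, h)"] by simp

lemma col_orbit_mat:
  fixes \<rho> :: "'a::{field,finite} vec \<times> 'a mat \<Rightarrow> complex mat"
  assumes "representation G0 n \<rho>" "v \<in> carrier_vec n" "j < card (H0 :: 'a mat set)"
  shows "col (orbit_mat n \<rho> v) j = \<rho> (0\<^sub>v 2, h_enum j) *\<^sub>v v"
  using carrier_vecD[OF rep_vec_carrier[OF assms(1,2) N0_zero h_enum_in_H0[OF assms(3)]]] assms(3)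
  by (intro eq_vecI) (auto simp: orbit_mat_def simp del: index_mult_mat_vec dim_mult_mat_vec)

text \<open>Column by column: \<open>(z, h)(0, h_enum j) = (z, 1)(0, h_enum k)\<close> with
  \<open>h_enum k = h * h_enum j\<close>, and the translate by \<open>h_enum k\<close> is a weight
  vector, so \<open>(z, 1)\<close> scales it by the corresponding entry of
  \<open>induced \<chi> g\<close>.\<close>

lemma orbit_mat_intertwines:
  fixes \<rho> :: "'a::{field,finite} vec \<times> 'a mat \<Rightarrow> complex mat"
  assumes rep: "representation G0 n \<rho>" and v: "weight_vec n \<rho> \<chi> v" and g: "g \<in> carrier G0"
  shows "\<rho> g * orbit_mat n \<rho> v = orbit_mat n \<rho> v * induced \<chi> g"
proof (rule eq_matI)
  let ?m = "card (H0 :: 'a mat set)" and ?Q = "orbit_mat n \<rho> v"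
  have \<rho>g: "\<rho> g \<in> carrier_mat n n" using rep_carrier[OF rep g] .
  have vc: "v \<in> carrier_vec n" using v by (simp add: weight_vec_def)
  obtain z h where zh: "g = (z, h)" "z \<in> N0" "h \<in> H0" using g by (cases g) auto
  fix i j assume "i < dim_row (?Q * induced \<chi> g)" "j < dim_col (?Q * induced \<chi> g)"
  then have ij: "i < n" "j < ?m" using orbit_mat_carrier[of n \<rho> v] induced_carrier[of \<chi> g] by auto
  have Hj: "(h_enum j :: 'a mat) \<in> H0" using ij by (auto intro: h_enum_in_H0)
  obtain k where k: "k < ?m" "h_enum k = h * h_enum j"
    using h_enum_surj[OF H0_mult_closed[OF zh(3) Hj]] by blast
  have Hk: "(h_enum k :: 'a mat) \<in> H0" using k(1) by (rule h_enum_in_H0)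
  let ?w = "\<rho> (0\<^sub>v 2, h_enum k) *\<^sub>v v"
  have h0: "h *\<^sub>v 0\<^sub>v 2 = 0\<^sub>v 2" using H0_carrier[OF zh(3)] by auto
  have 1: "1\<^sub>m 2 *\<^sub>v 0\<^sub>v 2 = (0\<^sub>v 2 :: 'a vec)" "1\<^sub>m 2 * h_enum k = (h_enum k :: 'a mat)"
    using H0_carrier[OF Hk] by auto
  have "(\<rho> g * ?Q) $$ (i, j) = (\<rho> g *\<^sub>v (\<rho> (0\<^sub>v 2, h_enum j) *\<^sub>v v)) $ i"
    using ij \<rho>g orbit_mat_carrier[of n \<rho> v] by (simp add: col_orbit_mat[OF rep vc])
  also have "\<rho> g *\<^sub>v (\<rho> (0\<^sub>v 2, h_enum j) *\<^sub>v v) = \<rho> (z, h_enum k) *\<^sub>v v"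
    using rep_mult_vec[OF rep g, of "(0\<^sub>v 2, h_enum j)" v] vc zh Hj h0 k by (simp add: N0_zero) (simp add: N0_def)
  also have "\<dots> = \<rho> (z, 1\<^sub>m 2) *\<^sub>v ?w"
    using rep_mult_vec[OF rep _ _ vc, of "(z, 1\<^sub>m 2)" "(0\<^sub>v 2, h_enum k)"] zh Hk 1 one_in_H0[where 'a = 'a]
    by (simp add: N0_zero) (simp add: N0_def)
  also have "\<dots> = \<chi> (hinv (h_enum k) *\<^sub>v z) \<cdot>\<^sub>v ?w"
    using weight_vec_translate[OF rep Hk v] zh by (simp add: weight_vec_def)
  also have "\<dots> $ i = \<chi> (hinv (h_enum k) *\<^sub>v z) * ?w $ i"
    using carrier_vecD[OF rep_vec_carrier[OF rep vc N0_zero Hk]] ij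
    by (simp del: index_mult_mat_vec dim_mult_mat_vec)
  also have "\<dots> = (\<Sum>l\<in>{0..<?m}. if l = k then ?Q $$ (i, l) * \<chi> (hinv (h_enum k) *\<^sub>v z) else 0)"
    using k ij by (simp add: orbit_mat_def mult.commute)
  also have "\<dots> = (\<Sum>l\<in>{0..<?m}. ?Q $$ (i, l) * induced \<chi> g $$ (l, j))"
    by (rule sum.cong) (use ij k in \<open>auto simp: zh(1) induced_entry h_enum_inj simp flip: k(2)\<close>)
  also have "\<dots> = (?Q * induced \<chi> g) $$ (i, j)"
    using ij orbit_mat_carrier[of n \<rho> v] induced_carrier[of \<chi> g] by (auto simp: scalar_prod_def)
  finally show "(\<rho> g * ?Q) $$ (i, j) = (?Q * induced \<chi> g) $$ (i, j)" .
qed (use rep_carrier[OF rep g] orbit_mat_carrier[of n \<rho> v] induced_carrier[of \<chi> g] in auto)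

lemma translate_nonzero:
  assumes rep: "representation G0 n \<rho>" and h: "h \<in> H0" and v: "v \<in> carrier_vec n" "v \<noteq> 0\<^sub>v n"
  shows "\<rho> (0\<^sub>v 2, h) *\<^sub>v v \<noteq> 0\<^sub>v n"
proof
  assume "\<rho> (0\<^sub>v 2, h) *\<^sub>v v = 0\<^sub>v n"
  then have "\<rho> (0\<^sub>v 2, hinv h) *\<^sub>v (\<rho> (0\<^sub>v 2, h) *\<^sub>v v) = 0\<^sub>v n"
    using rep_carrier[OF rep, of "(0\<^sub>v 2, hinv h)"] h by (auto simp: N0_zero hinv)
  moreover have "hinv h *\<^sub>v 0\<^sub>v 2 = 0\<^sub>v 2" using H0_carrier[OF hinv(1)[OF h]] by auto
  ultimately have "\<rho> (0\<^sub>v 2, 1\<^sub>m 2) *\<^sub>v v = 0\<^sub>v n"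
    using rep_mult_vec[OF rep, of "(0\<^sub>v 2, hinv h)" "(0\<^sub>v 2, h)" v] v h by (simp add: N0_zero hinv)
  then show False using rep_one[OF rep group_G0] v by simp
qed

lemma act_hinv_enum_inj:
  fixes \<chi> :: "'a::{field,finite} vec \<Rightarrow> complex"
  assumes "(2::'a) \<noteq> 0" "\<chi> \<in> N0_chars" "\<chi> \<noteq> triv_N0"
  shows "inj_on (\<lambda>j. act (hinv (h_enum j)) \<chi>) {0..<card (H0 :: 'a mat set)}"
proof (rule inj_onI)
  fix i j assume ij: "i \<in> {0..<card (H0 :: 'a mat set)}" "j \<in> {0..<card (H0 :: 'a mat set)}"
    and eq: "act (hinv (h_enum i)) \<chi> = act (hinv (h_enum j)) \<chi>"
  then have H: "(h_enum i :: 'a mat) \<in> H0" "(h_enum j :: 'a mat) \<in> H0" by (auto intro: h_enum_in_H0)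
  have "hinv (h_enum i) = (hinv (h_enum j) :: 'a mat)"
    using inj_onD[OF act_inj[OF assms] eq] H by (simp add: hinv)
  then have "hinv (hinv (h_enum i)) = (hinv (hinv (h_enum j)) :: 'a mat)" by (rule arg_cong)
  then have "h_enum i = (h_enum j :: 'a mat)" unfolding hinv(4)[OF H(1)] hinv(4)[OF H(2)] .
  then show "i = j" using ij h_enum_inj[where 'a = 'a] by auto
qed

text \<open>Applying all \<open>\<rho> (z, 1\<^sub>m 2)\<close> to a vanishing combination of
  columns yields, in each coordinate, a relation between the weights of the columns as functions of
  \<open>z\<close>. These weights are distinct characters, so every coefficient vanishes.\<close>

lemma orbit_mat_inj:
  fixes \<rho> :: "'a::{field,finite} vec \<times> 'a mat \<Rightarrow> complex mat"
  assumes two: "(2::'a) \<noteq> 0" and rep: "representation G0 n \<rho>" and \<chi>: "\<chi> \<in> N0_chars" "\<chi> \<noteq> triv_N0"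
    and v: "weight_vec n \<rho> \<chi> v" "v \<noteq> 0\<^sub>v n"
    and x: "x \<in> carrier_vec (card (H0 :: 'a mat set))" "orbit_mat n \<rho> v *\<^sub>v x = 0\<^sub>v n"
  shows "x = 0\<^sub>v (card (H0 :: 'a mat set))"
proof (rule eq_vecI)
  let ?m = "card (H0 :: 'a mat set)"
  fix j assume "j < dim_vec (0\<^sub>v ?m :: complex vec)"
  then have j: "j < ?m" by simp
  let ?w = "\<lambda>j. \<rho> (0\<^sub>v 2, h_enum j) *\<^sub>v v"
  have vc: "v \<in> carrier_vec n" using v by (simp add: weight_vec_def)
  have w: "?w l \<in> carrier_vec n" if "l < ?m" for l
    using rep_vec_carrier[OF rep vc N0_zero h_enum_in_H0[OF that]] .
  have "?w j \<noteq> 0\<^sub>v n" using translate_nonzero[OF rep h_enum_in_H0[OF j] vc v(2)] .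
  \<comment> \<open>The relation is read in a coordinate where column \<open>j\<close> is nonzero,
    so that the coefficient \<open>x $ j\<close> can be recovered at the end.\<close>
  then obtain i where i: "i < n" "?w j $ i \<noteq> 0" using w[OF j] by (metis carrier_vecD eq_vecI index_zero_vec)
  have Qx: "0\<^sub>v n = vsum n {0..<?m} (\<lambda>l. x $ l \<cdot>\<^sub>v ?w l)"
  proof -
    have "0\<^sub>v n = vsum n {0..<?m} (\<lambda>l. x $ l \<cdot>\<^sub>v col (orbit_mat n \<rho> v) l)"
      using mat_mult_vec_as_vsum[OF orbit_mat_carrier x(1), of n \<rho> v] x(2) by simp
    also have "\<dots> = vsum n {0..<?m} (\<lambda>l. x $ l \<cdot>\<^sub>v ?w l)"
      unfolding vsum_def by (intro arg_cong[where f = "vec n"] ext sum.cong refl) (simp add: col_orbit_mat[OF rep vc])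
    finally show ?thesis .
  qed
  interpret N: comm_group "N0_grp :: 'a vec monoid" by (rule N0_grp_comm_group)
  have "x $ j * ?w j $ i = 0"
  proof (rule N.chars_independent[where c = "\<lambda>l. x $ l * ?w l $ i"])
    show "inj_on (\<lambda>l. act (hinv (h_enum l)) \<chi>) {0..<?m}" by (rule act_hinv_enum_inj[OF two \<chi>])
    show "act (hinv (h_enum l)) \<chi> \<in> N0_chars" if "l \<in> {0..<?m}" for l
      using that \<chi> by (intro act_chars hinv h_enum_in_H0) auto
    fix z :: "'a vec" assume "z \<in> carrier N0_grp"
    then have z: "z \<in> N0" by simp
    have \<rho>z: "\<rho> (z, 1\<^sub>m 2) \<in> carrier_mat n n" using rep_carrier[OF rep, of "(z, 1\<^sub>m 2)"] z by (simp add: one_in_H0)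
    have "\<rho> (z, 1\<^sub>m 2) *\<^sub>v 0\<^sub>v n = vsum n {0..<?m} (\<lambda>l. \<rho> (z, 1\<^sub>m 2) *\<^sub>v (x $ l \<cdot>\<^sub>v ?w l))"
      unfolding Qx using w by (intro mult_mat_vsum[OF \<rho>z]) auto
    moreover have "\<rho> (z, 1\<^sub>m 2) *\<^sub>v 0\<^sub>v n = 0\<^sub>v n" using \<rho>z by auto
    ultimately have "0 = vsum n {0..<?m} (\<lambda>l. \<rho> (z, 1\<^sub>m 2) *\<^sub>v (x $ l \<cdot>\<^sub>v ?w l)) $ i"
      using i(1) by (metis index_zero_vec(1))
    also have "\<dots> = (\<Sum>l\<in>{0..<?m}. act (hinv (h_enum l)) \<chi> z * (x $ l * ?w l $ i))"
      unfolding vsum_def index_vec[OF i(1)]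
    proof (rule sum.cong)
      fix l assume "l \<in> {0..<?m}"
      then have l: "l < ?m" by simp
      have "\<rho> (z, 1\<^sub>m 2) *\<^sub>v (x $ l \<cdot>\<^sub>v ?w l) = x $ l \<cdot>\<^sub>v (act (hinv (h_enum l)) \<chi> z \<cdot>\<^sub>v ?w l)"
        using weight_vec_translate[OF rep h_enum_in_H0[OF l] v(1)] z mult_mat_vec[OF \<rho>z w[OF l]]
        by (simp add: weight_vec_def)
      then show "(\<rho> (z, 1\<^sub>m 2) *\<^sub>v (x $ l \<cdot>\<^sub>v ?w l)) $ i = act (hinv (h_enum l)) \<chi> z * (x $ l * ?w l $ i)"
        using carrier_vecD[OF w[OF l]] i by (simp del: index_mult_mat_vec dim_mult_mat_vec)
    qed simp
    finally show "(\<Sum>l\<in>{0..<?m}. act (hinv (h_enum l)) \<chi> z * (x $ l * ?w l $ i)) = 0" by simp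
  qed (use j in \<open>auto simp: finite_N0\<close>)
  then show "x $ j = 0\<^sub>v ?m $ j" using i j by simp
qed (use x in simp)

text \<open>One nontrivial weight vector already embeds a space of dimension \<open>card H0\<close>;
  this covers reducible representations as well.\<close>

lemma type_II_degree_ge:
  fixes \<rho> :: "'a::{field,finite} vec \<times> 'a mat \<Rightarrow> complex mat"
  assumes two: "(2::'a) \<noteq> 0" and "type_II n \<rho>"
  shows "card (H0 :: 'a mat set) \<le> n"
proof -
  have rep: "representation G0 n \<rho>" using assms by (simp add: type_II_def)
  obtain \<chi> v where "\<chi> \<in> N0_chars" "\<chi> \<noteq> triv_N0" "v \<noteq> 0\<^sub>v n" "weight_vec n \<rho> \<chi> v"
    using type_II_weight[OF assms(2)] by blast
  then show ?thesis using orbit_mat_inj[OF two rep] injective_mat_dim_le[OF orbit_mat_carrier] by blast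
qed

text \<open>The range of \<open>orbit_mat\<close> is a nonzero invariant subspace, hence the whole
  space. Being injective too, the matrix is square and invertible, and it intertwines.\<close>

lemma irreducible_rep_iso_induced:
  fixes \<rho> :: "'a::{field,finite} vec \<times> 'a mat \<Rightarrow> complex mat"
  assumes two: "(2::'a) \<noteq> 0" and irr: "irreducible_rep G0 n \<rho>" and \<chi>: "\<chi> \<in> N0_chars" "\<chi> \<noteq> triv_N0"
    and v: "weight_vec n \<rho> \<chi> v" "v \<noteq> 0\<^sub>v n"
  shows "n = card (H0 :: 'a mat set)" "((n, induced \<chi>), (n, \<rho>)) \<in> rep_iso G0"
proof -
  let ?m = "card (H0 :: 'a mat set)" and ?Q = "orbit_mat n \<rho> v"
  have rep: "representation G0 n \<rho>" using irr by (simp add: irreducible_rep_def)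
  note inj = orbit_mat_inj[OF two rep \<chi> v]
  define W where "W = (\<lambda>x. ?Q *\<^sub>v x) ` carrier_vec ?m"
  have "vec_subspace n W"
    unfolding vec_subspace_iff
  proof (intro conjI ballI allI)
    show "W \<subseteq> carrier_vec n" using orbit_mat_carrier[of n \<rho> v] by (auto simp: W_def)
    have "0\<^sub>v n = ?Q *\<^sub>v 0\<^sub>v ?m" using orbit_mat_carrier[of n \<rho> v] by auto
    then show "0\<^sub>v n \<in> W" unfolding W_def by (rule image_eqI) simp
    fix x assume "x \<in> W"
    then obtain x' where x: "x = ?Q *\<^sub>v x'" "x' \<in> carrier_vec ?m" by (auto simp: W_def)
    show "c \<cdot>\<^sub>v x \<in> W" for c
      unfolding W_def x(1) mult_mat_vec[OF orbit_mat_carrier x(2), symmetric]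
      by (rule imageI) (use x in simp)
    fix y assume "y \<in> W"
    then obtain y' where y: "y = ?Q *\<^sub>v y'" "y' \<in> carrier_vec ?m" by (auto simp: W_def)
    show "x + y \<in> W"
      unfolding W_def x(1) y(1) mult_add_distrib_mat_vec[OF orbit_mat_carrier x(2) y(2), symmetric]
      by (rule imageI) (use x y in simp)
  qed
  moreover have "\<rho> g *\<^sub>v w \<in> W" if g: "g \<in> carrier G0" and w: "w \<in> W" for g w
  proof -
    obtain x where x: "w = ?Q *\<^sub>v x" "x \<in> carrier_vec ?m" using w by (auto simp: W_def)
    have "\<rho> g *\<^sub>v w = (\<rho> g * ?Q) *\<^sub>v x"
      unfolding x(1) using assoc_mult_mat_vec[OF rep_carrier[OF rep g] orbit_mat_carrier x(2)] by simp
    also have "\<dots> = ?Q *\<^sub>v (induced \<chi> g *\<^sub>v x)"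
      unfolding orbit_mat_intertwines[OF rep v(1) g]
      using assoc_mult_mat_vec[OF orbit_mat_carrier induced_carrier x(2)] by simp
    finally show ?thesis using mult_mat_vec_carrier[OF induced_carrier x(2)] by (auto simp: W_def)
  qed
  moreover have "W \<noteq> {0\<^sub>v n}"
  proof
    assume "W = {0\<^sub>v n}"
    then have "?Q *\<^sub>v unit_vec ?m 0 = 0\<^sub>v n" by (auto simp: W_def)
    then have "unit_vec ?m 0 = (0\<^sub>v ?m :: complex vec)" using inj by simp
    then show False using card_H0_pos[where 'a = 'a] by simp
  qed
  ultimately have "W = carrier_vec n" using irr unfolding irreducible_rep_def by blast
  have "\<exists>x\<in>carrier_vec ?m. ?Q *\<^sub>v x = y" if "y \<in> carrier_vec n" for y
    using that unfolding \<open>W = carrier_vec n\<close>[symmetric] W_def by blast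
  from bijective_mat_GL[OF orbit_mat_carrier inj this] have nm: "n = ?m" and Q: "?Q \<in> carrier (GL n)"
    by blast+
  show "n = ?m" by fact
  show "((n, induced \<chi>), (n, \<rho>)) \<in> rep_iso G0"
  proof -
    have "?Q * induced \<chi> g = \<rho> g * ?Q" if "g \<in> carrier G0" for g
      using orbit_mat_intertwines[OF rep v(1) that] by simp
    then show ?thesis unfolding rep_iso_def using Q rep induced_rep[OF \<chi>(1)] nm by blast
  qed
qed

section \<open>Irreducibility of the induced representation\<close>

text \<open>In the induced representation \<open>N0\<close> acts by diagonal matrices, so a nonzero
  coordinate \<open>k\<close> forces the weight to be the diagonal character at
  \<open>k\<close>.\<close>

lemma weight_vec_induced_coord:
  fixes \<chi> :: "'a::{field,finite} vec \<Rightarrow> complex"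
  assumes \<psi>: "\<psi> \<in> N0_chars" and \<chi>: "\<chi> \<in> N0_chars"
    and u: "weight_vec (card (H0 :: 'a mat set)) (induced \<chi>) \<psi> u"
    and k: "k < card (H0 :: 'a mat set)" "u $ k \<noteq> 0"
  shows "\<psi> = act (hinv (h_enum k)) \<chi>"
proof (rule N0_chars_eqI[OF \<psi>])
  let ?m = "card (H0 :: 'a mat set)"
  have Hk: "(h_enum k :: 'a mat) \<in> H0" using k(1) by (rule h_enum_in_H0)
  then show "act (hinv (h_enum k)) \<chi> \<in> N0_chars" using \<chi> by (simp add: act_chars hinv)
  fix z :: "'a vec" assume z: "z \<in> N0"
  have uc: "u \<in> carrier_vec ?m" using u by (simp add: weight_vec_def)
  have "1\<^sub>m 2 * h_enum l = (h_enum l :: 'a mat)" if "l < ?m" for l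
    using H0_carrier[OF h_enum_in_H0[OF that]] by simp
  then have e: "induced \<chi> (z, 1\<^sub>m 2) $$ (k, l) = (if l = k then \<chi> (hinv (h_enum k) *\<^sub>v z) else 0)" if "l < ?m" for l
    using k that by (auto simp: induced_entry h_enum_inj)
  have "(induced \<chi> (z, 1\<^sub>m 2) *\<^sub>v u) $ k = (\<Sum>l\<in>{0..<?m}. induced \<chi> (z, 1\<^sub>m 2) $$ (k, l) * u $ l)"
    using k uc carrier_matD[OF induced_carrier[of \<chi> "(z, 1\<^sub>m 2)"]] by (auto simp: scalar_prod_def)
  also have "\<dots> = (\<Sum>l\<in>{0..<?m}. if l = k then \<chi> (hinv (h_enum k) *\<^sub>v z) * u $ k else 0)"
    by (rule sum.cong) (auto simp: e)
  also have "\<dots> = \<chi> (hinv (h_enum k) *\<^sub>v z) * u $ k" using k by simp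
  finally have "\<psi> z * u $ k = \<chi> (hinv (h_enum k) *\<^sub>v z) * u $ k"
    using u z k uc by (simp add: weight_vec_def)
  then show "\<psi> z = act (hinv (h_enum k)) \<chi> z" using k z by simp
qed

lemma unit_vec_weight_induced:
  fixes \<chi> :: "'a::{field,finite} vec \<Rightarrow> complex"
  assumes k: "k < card (H0 :: 'a mat set)"
  shows "weight_vec (card (H0 :: 'a mat set)) (induced \<chi>) (act (hinv (h_enum k)) \<chi>) (unit_vec (card (H0 :: 'a mat set)) k)"
  unfolding weight_vec_def
proof (intro conjI ballI eq_vecI)
  let ?m = "card (H0 :: 'a mat set)"
  fix z :: "'a vec" assume z: "z \<in> N0"
  have Hk: "1\<^sub>m 2 * h_enum k = (h_enum k :: 'a mat)" using H0_carrier[OF h_enum_in_H0[OF k]] by simp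
  note dim = carrier_matD[OF induced_carrier[of \<chi> "(z, 1\<^sub>m 2)"]]
  fix i assume "i < dim_vec (act (hinv (h_enum k)) \<chi> z \<cdot>\<^sub>v unit_vec ?m k)"
  then have i: "i < ?m" by simp
  have "(induced \<chi> (z, 1\<^sub>m 2) *\<^sub>v unit_vec ?m k) $ i = induced \<chi> (z, 1\<^sub>m 2) $$ (i, k)"
    using i k dim by simp
  then show "(induced \<chi> (z, 1\<^sub>m 2) *\<^sub>v unit_vec ?m k) $ i = (act (hinv (h_enum k)) \<chi> z \<cdot>\<^sub>v unit_vec ?m k) $ i"
    using i k z by (cases "i = k") (simp_all add: induced_entry h_enum_inj Hk)
qed (use carrier_matD[OF induced_carrier[of \<chi>]] in simp_all)

text \<open>\<open>H0\<close> permutes the basis transitively, because it acts on its own elements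
  by multiplication.\<close>

lemma induced_translate_unit_vec:
  fixes \<chi> :: "'a::{field,finite} vec \<Rightarrow> complex"
  assumes \<chi>: "\<chi> \<in> N0_chars" and kj: "k < card (H0 :: 'a mat set)" "j < card (H0 :: 'a mat set)"
  shows "induced \<chi> (0\<^sub>v 2, h_enum j * hinv (h_enum k)) *\<^sub>v unit_vec (card (H0 :: 'a mat set)) k
    = unit_vec (card (H0 :: 'a mat set)) j"
proof (rule eq_vecI)
  let ?m = "card (H0 :: 'a mat set)" and ?h = "h_enum j * hinv (h_enum k) :: 'a mat"
  note dim = carrier_matD[OF induced_carrier[of \<chi> "(0\<^sub>v 2, ?h)"]]
  fix i assume "i < dim_vec (unit_vec ?m j :: complex vec)"
  then have i: "i < ?m" by simp
  have H: "(h_enum k :: 'a mat) \<in> H0" "(h_enum j :: 'a mat) \<in> H0" "(h_enum i :: 'a mat) \<in> H0"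
    using kj i by (auto intro: h_enum_in_H0)
  have "?h * h_enum k = h_enum j"
    using H H0_carrier[OF H(2)] by (simp add: H0_assoc hinv)
  moreover have "hinv (h_enum i) *\<^sub>v 0\<^sub>v 2 = (0\<^sub>v 2 :: 'a vec)"
    using H0_carrier[OF hinv(1)[OF H(3)]] by auto
  moreover have "(induced \<chi> (0\<^sub>v 2, ?h) *\<^sub>v unit_vec ?m k) $ i = induced \<chi> (0\<^sub>v 2, ?h) $$ (i, k)"
    using i kj dim by simp
  ultimately show "(induced \<chi> (0\<^sub>v 2, ?h) *\<^sub>v unit_vec ?m k) $ i = unit_vec ?m j $ i"
    using i kj \<chi> by (cases "i = j") (simp_all add: induced_entry h_enum_inj N0_char_zero)
qed (use carrier_matD[OF induced_carrier[of \<chi>]] in simp_all)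

text \<open>A nonzero invariant subspace contains a nonzero weight vector. The basis vectors have
  distinct weights, so this vector is a multiple of one of them, and \<open>H0\<close> moves it to
  all the others.\<close>

lemma induced_irreducible:
  fixes \<chi> :: "'a::{field,finite} vec \<Rightarrow> complex"
  assumes two: "(2::'a) \<noteq> 0" and \<chi>: "\<chi> \<in> N0_chars" "\<chi> \<noteq> triv_N0"
  shows "irreducible_rep G0 (card (H0 :: 'a mat set)) (induced \<chi>)"
  unfolding irreducible_rep_def
proof (intro conjI allI impI)
  let ?m = "card (H0 :: 'a mat set)"
  show rep: "representation G0 ?m (induced \<chi>)" using \<chi>(1) by (rule induced_rep)
  show "?m \<noteq> 0" using card_H0_pos[where 'a = 'a] by simp
  fix W assume W: "vec_subspace ?m W" and inv: "\<forall>g\<in>carrier G0. \<forall>w\<in>W. induced \<chi> g *\<^sub>v w \<in> W"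
  show "W = {0\<^sub>v ?m} \<or> W = carrier_vec ?m"
  proof (rule disjCI)
    assume "W \<noteq> carrier_vec ?m"
    show "W = {0\<^sub>v ?m}"
    proof (rule ccontr)
      assume "W \<noteq> {0\<^sub>v ?m}"
      then obtain w where w: "w \<in> W" "w \<noteq> 0\<^sub>v ?m" using W by (auto simp: vec_subspace_iff)
      have wc: "w \<in> carrier_vec ?m" using w W by (auto simp: vec_subspace_iff)
      have fin: "finite (carrier (N0_grp :: 'a vec monoid))" by (simp add: finite_N0)
      have inv': "\<forall>z\<in>carrier (N0_grp :: 'a vec monoid). \<forall>w\<in>W. induced \<chi> (z, 1\<^sub>m 2) *\<^sub>v w \<in> W"
        using inv by (auto simp: one_in_H0)
      from comm_group.rep_char_decomposition[OF N0_grp_comm_group fin rep_N0[OF rep] wc]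
      obtain u where u: "\<And>\<psi>. \<psi> \<in> N0_chars \<Longrightarrow> weight_vec ?m (induced \<chi>) \<psi> (u \<psi>)" "w = vsum ?m N0_chars u"
        "\<And>\<psi>. \<psi> \<in> N0_chars \<Longrightarrow> u \<psi> \<in> W"
        unfolding weight_vec_def using W inv' w(1) by simp metis
      have "\<exists>\<psi>\<in>N0_chars. u \<psi> \<noteq> 0\<^sub>v ?m"
      proof (rule ccontr)
        assume "\<not> ?thesis"
        then have "vsum ?m N0_chars u = 0\<^sub>v ?m" by (auto simp: vsum_def)
        then show False using u(2) w(2) by simp
      qed
      then obtain \<psi> where \<psi>: "\<psi> \<in> N0_chars" "u \<psi> \<noteq> 0\<^sub>v ?m" by blast
      have uc: "u \<psi> \<in> carrier_vec ?m" using u(1)[OF \<psi>(1)] by (simp add: weight_vec_def)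
      then obtain k where k: "k < ?m" "u \<psi> $ k \<noteq> 0" using \<psi>(2) by (metis carrier_vecD eq_vecI index_zero_vec)
      note coord = weight_vec_induced_coord[OF \<psi>(1) \<chi>(1) u(1)[OF \<psi>(1)]]
      have "u \<psi> $ i = 0" if i: "i < ?m" "i \<noteq> k" for i
      proof (rule ccontr)
        assume "u \<psi> $ i \<noteq> 0"
        then have "act (hinv (h_enum i)) \<chi> = act (hinv (h_enum k)) \<chi>"
          using coord[OF i(1)] coord[OF k] by simp
        then show False using inj_onD[OF act_hinv_enum_inj[OF two \<chi>], of i k] i k by simp
      qed
      \<comment> \<open>Only coordinate \<open>k\<close> of \<open>u \<psi>\<close> survives;
        rescaling by its value puts a basis vector into \<open>W\<close>.\<close>
      then have "unit_vec ?m k = (1 / u \<psi> $ k) \<cdot>\<^sub>v u \<psi>" using k uc by (intro eq_vecI) auto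
      then have ek: "unit_vec ?m k \<in> W" using W u(3)[OF \<psi>(1)] by (simp add: vec_subspace_iff)
      have ej: "unit_vec ?m j \<in> W" if j: "j < ?m" for j
      proof -
        have "(0\<^sub>v 2, h_enum j * hinv (h_enum k)) \<in> carrier (G0 :: ('a vec \<times> 'a mat) monoid)"
          using h_enum_in_H0[OF k(1)] h_enum_in_H0[OF j] by (simp add: N0_zero H0_mult_closed hinv)
        then show ?thesis using inv ek induced_translate_unit_vec[OF \<chi>(1) k(1) j] by metis
      qed
      have "v \<in> W" if v: "v \<in> carrier_vec ?m" for v
        using vsum_closed[OF W, of "{0..<?m}" "\<lambda>j. v $ j \<cdot>\<^sub>v unit_vec ?m j"] ej W vec_as_vsum[OF v]
        by (simp add: vec_subspace_iff)
      then have "W = carrier_vec ?m" using W by (auto simp: vec_subspace_iff)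
      then show False using \<open>W \<noteq> carrier_vec ?m\<close> by blast
    qed
  qed
qed

section \<open>Nontrivial weights as a complete invariant\<close>

text \<open>Leaving out the trivial character makes this set empty in type I and, for an irreducible
  of type II, exactly one orbit of \<open>H0\<close>.\<close>

definition spectrum_N0 :: "nat \<Rightarrow> ('a::field vec \<times> 'a mat \<Rightarrow> complex mat) \<Rightarrow> ('a vec \<Rightarrow> complex) set" where
  "spectrum_N0 n \<rho> = {\<psi> \<in> N0_chars. \<psi> \<noteq> triv_N0 \<and> (\<exists>v. v \<noteq> 0\<^sub>v n \<and> weight_vec n \<rho> \<psi> v)}"

lemma act_nontriv:
  assumes "h \<in> H0" "\<chi> \<in> N0_chars" "\<chi> \<noteq> triv_N0"
  shows "act h \<chi> \<noteq> triv_N0"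
proof
  assume "act h \<chi> = triv_N0"
  then have "act (hinv h) (act h \<chi>) = act (hinv h) triv_N0" by simp
  then show False using assms by (simp add: act_act act_one act_triv hinv)
qed

lemma spectrum_induced:
  fixes \<chi> :: "'a::{field,finite} vec \<Rightarrow> complex"
  assumes \<chi>: "\<chi> \<in> N0_chars" "\<chi> \<noteq> triv_N0"
  shows "spectrum_N0 (card (H0 :: 'a mat set)) (induced \<chi>) = (\<lambda>h. act h \<chi>) ` H0"
proof (intro equalityI subsetI)
  let ?m = "card (H0 :: 'a mat set)"
  fix \<psi> assume "\<psi> \<in> spectrum_N0 ?m (induced \<chi>)"
  then obtain v where v: "\<psi> \<in> N0_chars" "v \<noteq> 0\<^sub>v ?m" "weight_vec ?m (induced \<chi>) \<psi> v"
    by (auto simp: spectrum_N0_def)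
  have "v \<in> carrier_vec ?m" using v by (simp add: weight_vec_def)
  then obtain k where k: "k < ?m" "v $ k \<noteq> 0" using v(2) by (metis carrier_vecD eq_vecI index_zero_vec)
  show "\<psi> \<in> (\<lambda>h. act h \<chi>) ` H0"
    unfolding weight_vec_induced_coord[OF v(1) \<chi>(1) v(3) k]
    by (rule imageI) (rule hinv(1)[OF h_enum_in_H0[OF k(1)]])
next
  let ?m = "card (H0 :: 'a mat set)"
  fix \<psi> assume "\<psi> \<in> (\<lambda>h. act h \<chi>) ` (H0 :: 'a mat set)"
  then obtain h :: "'a mat" where h: "h \<in> H0" "\<psi> = act h \<chi>" by auto
  \<comment> \<open>Basis vector \<open>k\<close> has weight
    \<open>act (hinv (h_enum k)) \<chi>\<close>, so the index belongs to
    \<open>hinv h\<close>.\<close>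
  obtain k where k: "k < ?m" "h_enum k = hinv h" using h_enum_surj[OF hinv(1)[OF h(1)]] by blast
  have "weight_vec ?m (induced \<chi>) \<psi> (unit_vec ?m k)"
    using unit_vec_weight_induced[OF k(1), of \<chi>] h by (simp add: k hinv)
  moreover have "unit_vec ?m k \<noteq> (0\<^sub>v ?m :: complex vec)" using k(1) by simp
  ultimately show "\<psi> \<in> spectrum_N0 ?m (induced \<chi>)"
    using h(2) act_chars[OF \<chi>(1) h(1)] act_nontriv[OF h(1) \<chi>] unfolding spectrum_N0_def
    by (intro CollectI conjI exI[of _ "unit_vec ?m k"]) simp_all
qed

text \<open>An intertwiner carries weight vectors to vectors of the same weight, and invertibility
  keeps them nonzero.\<close>

lemma spectrum_iso_subset:
  fixes \<rho> \<sigma> :: "'a::field vec \<times> 'a mat \<Rightarrow> complex mat"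
  assumes "((n, \<rho>), (m, \<sigma>)) \<in> rep_iso G0"
  shows "spectrum_N0 n \<rho> \<subseteq> spectrum_N0 m \<sigma>"
proof
  fix \<psi> assume "\<psi> \<in> spectrum_N0 n \<rho>"
  then obtain v where v: "\<psi> \<in> N0_chars" "\<psi> \<noteq> triv_N0" "v \<noteq> 0\<^sub>v n" "weight_vec n \<rho> \<psi> v"
    by (auto simp: spectrum_N0_def)
  have *: "representation G0 n \<rho> \<and> representation G0 m \<sigma> \<and> n = m \<and>
      (\<exists>P\<in>carrier (GL n). \<forall>g\<in>carrier G0. P * \<rho> g = \<sigma> g * P)"
    using assms unfolding rep_iso_def mem_Collect_eq prod.case .
  then have m: "m = n" and rep: "representation G0 n \<rho>" "representation G0 n \<sigma>" by blast+
  from * obtain P where P: "P \<in> carrier (GL n)" "\<forall>g\<in>carrier G0. P * \<rho> g = \<sigma> g * P" by blast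
  obtain Q where Q: "P \<in> carrier_mat n n" "Q \<in> carrier_mat n n" "Q * P = 1\<^sub>m n"
    using P(1) unfolding GL_iff by blast
  have vc: "v \<in> carrier_vec n" using v by (simp add: weight_vec_def)
  have "P *\<^sub>v v \<noteq> 0\<^sub>v n"
  proof
    assume "P *\<^sub>v v = 0\<^sub>v n"
    moreover have "v = Q *\<^sub>v (P *\<^sub>v v)" using assoc_mult_mat_vec[OF Q(2) Q(1) vc] vc Q(3) by simp
    moreover have "Q *\<^sub>v 0\<^sub>v n = 0\<^sub>v n" using Q by auto
    ultimately show False using v(3) by simp
  qed
  moreover have "weight_vec n \<sigma> \<psi> (P *\<^sub>v v)"
    unfolding weight_vec_def
  proof (intro conjI ballI)
    show "P *\<^sub>v v \<in> carrier_vec n" using Q(1) vc by simp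
    fix z :: "'a vec" assume z: "z \<in> N0"
    let ?g = "(z, 1\<^sub>m 2 :: 'a mat)"
    have g: "?g \<in> carrier G0" using z by (simp add: one_in_H0)
    have "\<sigma> ?g *\<^sub>v (P *\<^sub>v v) = (P * \<rho> ?g) *\<^sub>v v"
      using assoc_mult_mat_vec[OF rep_carrier[OF rep(2) g] Q(1) vc] P(2) g by simp
    also have "\<dots> = P *\<^sub>v (\<psi> z \<cdot>\<^sub>v v)"
      using assoc_mult_mat_vec[OF Q(1) rep_carrier[OF rep(1) g] vc] v(4) z by (simp add: weight_vec_def)
    also have "\<dots> = \<psi> z \<cdot>\<^sub>v (P *\<^sub>v v)" using Q(1) vc by (rule mult_mat_vec)
    finally show "\<sigma> ?g *\<^sub>v (P *\<^sub>v v) = \<psi> z \<cdot>\<^sub>v (P *\<^sub>v v)" .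
  qed
  ultimately show "\<psi> \<in> spectrum_N0 m \<sigma>" using v m by (auto simp: spectrum_N0_def)
qed

lemma spectrum_iso: "((n, \<rho>), (m, \<sigma>)) \<in> rep_iso G0 \<Longrightarrow> spectrum_N0 n \<rho> = spectrum_N0 m \<sigma>"
  using spectrum_iso_subset rep_iso_sym by (metis subset_antisym)

lemma spectrum_type_I:
  assumes "type_I n \<rho>"
  shows "spectrum_N0 n \<rho> = {}"
proof -
  have False if \<psi>: "\<psi> \<in> N0_chars" "\<psi> \<noteq> triv_N0" and v: "v \<noteq> 0\<^sub>v n" "weight_vec n \<rho> \<psi> v" for \<psi> v
  proof -
    have vc: "v \<in> carrier_vec n" using v by (simp add: weight_vec_def)
    then obtain i where i: "i < n" "v $ i \<noteq> 0" using v(1) by (metis carrier_vecD eq_vecI index_zero_vec)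
    have "\<psi> z = 1" if "z \<in> N0" for z
    proof -
      have "v = \<psi> z \<cdot>\<^sub>v v" using v(2) assms that vc by (simp add: weight_vec_def type_I_def)
      then have "v $ i = \<psi> z * v $ i" using i vc by (metis carrier_vecD index_smult_vec(1))
      then show ?thesis using i by simp
    qed
    then have "\<psi> = triv_N0" using \<psi>(1) triv_N0_chars by (intro N0_chars_eqI) auto
    then show False using \<psi>(2) by simp
  qed
  then show ?thesis by (auto simp: spectrum_N0_def)
qed

lemma irr_type_II_iso_induced:
  fixes \<rho> :: "'a::{field,finite} vec \<times> 'a mat \<Rightarrow> complex mat"
  assumes two: "(2::'a) \<noteq> 0" and "(n, \<rho>) \<in> irr_type_II" and "\<psi> \<in> spectrum_N0 n \<rho>"
  shows "n = card (H0 :: 'a mat set)" "((n, induced \<psi>), (n, \<rho>)) \<in> rep_iso G0"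
  using irreducible_rep_iso_induced[OF two, of n \<rho> \<psi>] assms(2,3)
  by (auto simp: irr_type_II_def spectrum_N0_def)

lemma spectrum_irr_type_II:
  fixes \<rho> :: "'a::{field,finite} vec \<times> 'a mat \<Rightarrow> complex mat"
  assumes "(n, \<rho>) \<in> irr_type_II"
  obtains \<psi> where "\<psi> \<in> spectrum_N0 n \<rho>"
  using assms type_II_weight[of n \<rho>] by (auto simp: irr_type_II_def spectrum_N0_def)

lemma induced_irr_type_II:
  fixes \<chi> :: "'a::{field,finite} vec \<Rightarrow> complex"
  assumes two: "(2::'a) \<noteq> 0" and \<chi>: "\<chi> \<in> N0_chars" "\<chi> \<noteq> triv_N0"
  shows "(card (H0 :: 'a mat set), induced \<chi>) \<in> irr_type_II"
proof -
  have "spectrum_N0 (card (H0 :: 'a mat set)) (induced \<chi>) \<noteq> {}"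
    unfolding spectrum_induced[OF \<chi>] using one_in_H0 by blast
  then have "\<not> type_I (card (H0 :: 'a mat set)) (induced \<chi>)" using spectrum_type_I by blast
  then show ?thesis
    using induced_irreducible[OF assms] induced_rep[OF \<chi>(1)] by (simp add: irr_type_II_def type_II_def)
qed

text \<open>Classes correspond through \<open>spectrum_N0\<close> to orbits on the nontrivial
  characters, which partition a set of that size into pieces of size \<open>card H0\<close>. The
  product form avoids a division.\<close>

lemma card_irr_type_II_classes:
  assumes two: "(2::'a::{field,finite}) \<noteq> 0"
  shows "card (H0 :: 'a mat set) *
    card ((irr_type_II :: (nat \<times> ('a vec \<times> 'a mat \<Rightarrow> complex mat)) set) // rep_iso G0) = CARD('a)\<^sup>2 - 1"
proof -
  let ?S = "irr_type_II :: (nat \<times> ('a vec \<times> 'a mat \<Rightarrow> complex mat)) set"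
  let ?f = "\<lambda>(n, \<rho> :: 'a vec \<times> 'a mat \<Rightarrow> complex mat). spectrum_N0 n \<rho>"
  let ?X = "N0_chars - {triv_N0 :: 'a vec \<Rightarrow> complex}"
  let ?orb = "\<lambda>\<chi> :: 'a vec \<Rightarrow> complex. (\<lambda>h. act h \<chi>) ` (H0 :: 'a mat set)"
  have iso: "(x, y) \<in> rep_iso G0 \<longleftrightarrow> ?f x = ?f y" if xy: "x \<in> ?S" "y \<in> ?S" for x y
  proof -
    obtain n \<rho> m \<sigma> where [simp]: "x = (n, \<rho>)" "y = (m, \<sigma>)" by (cases x; cases y)
    show ?thesis
    proof
      assume "(x, y) \<in> rep_iso G0"
      then show "?f x = ?f y" using spectrum_iso by simp
    next
      \<comment> \<open>One common weight is enough: both representations are isomorphic to the one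
        induced from it.\<close>
      assume eq: "?f x = ?f y"
      obtain \<psi> where \<psi>: "\<psi> \<in> spectrum_N0 n \<rho>" using spectrum_irr_type_II xy(1) by auto
      then have \<psi>': "\<psi> \<in> spectrum_N0 m \<sigma>" using eq by simp
      note 1 = irr_type_II_iso_induced[OF two _ \<psi>] and 2 = irr_type_II_iso_induced[OF two _ \<psi>']
      have "((n, induced \<psi>), x) \<in> rep_iso G0" "((n, induced \<psi>), y) \<in> rep_iso G0"
        using 1 2 xy by auto
      then show "(x, y) \<in> rep_iso G0" using rep_iso_sym rep_iso_trans by blast
    qed
  qed
  have img: "?f ` ?S = ?orb ` ?X"
  proof (intro equalityI subsetI)
    fix Z assume "Z \<in> ?f ` ?S"
    then obtain n \<rho> where n\<rho>: "(n, \<rho>) \<in> ?S" "Z = spectrum_N0 n \<rho>" by auto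
    obtain \<psi> where \<psi>: "\<psi> \<in> spectrum_N0 n \<rho>" using spectrum_irr_type_II n\<rho>(1) by auto
    have \<psi>X: "\<psi> \<in> N0_chars" "\<psi> \<noteq> triv_N0" using \<psi> by (auto simp: spectrum_N0_def)
    have "Z = ?orb \<psi>"
      using irr_type_II_iso_induced[OF two n\<rho>(1) \<psi>] spectrum_iso spectrum_induced[OF \<psi>X] n\<rho>(2) by metis
    then show "Z \<in> ?orb ` ?X" using \<psi>X by blast
  next
    fix Z assume "Z \<in> ?orb ` ?X"
    then obtain \<chi> where \<chi>: "\<chi> \<in> N0_chars" "\<chi> \<noteq> triv_N0" "Z = ?orb \<chi>" by auto
    show "Z \<in> ?f ` ?S"
      using spectrum_induced[OF \<chi>(1,2)] induced_irr_type_II[OF two \<chi>(1,2)] \<chi>(3) by (auto simp: image_iff intro!: bexI)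
  qed
  have finN: "finite (carrier (N0_grp :: 'a vec monoid))" by (simp add: finite_N0)
  have finX: "finite ?X" using group.finite_chars[OF group_N0_grp finN] by simp
  have cardX: "card ?X = CARD('a)\<^sup>2 - 1"
    using comm_group.card_chars[OF N0_grp_comm_group finN] group.finite_chars[OF group_N0_grp finN] triv_N0_chars[where 'a = 'a]
    by (simp add: card_N0)
  have un: "\<Union>(?orb ` ?X) = ?X"
  proof (intro equalityI subsetI)
    fix \<psi> assume "\<psi> \<in> \<Union>(?orb ` ?X)"
    then show "\<psi> \<in> ?X" using act_chars act_nontriv by auto
  next
    fix \<psi> assume \<psi>: "\<psi> \<in> ?X"
    then have "\<psi> \<in> ?orb \<psi>" using act_one[of \<psi>] one_in_H0 by (metis DiffD1 image_eqI)
    then show "\<psi> \<in> \<Union>(?orb ` ?X)" using \<psi> by blast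
  qed
  \<comment> \<open>An orbit can be based at any of its points; hence orbits that meet
    coincide.\<close>
  have orb_eq: "?orb (act h \<chi>) = ?orb \<chi>" if h: "h \<in> H0" and \<chi>: "\<chi> \<in> N0_chars" for h \<chi>
  proof (intro equalityI subsetI)
    fix \<psi> assume "\<psi> \<in> ?orb (act h \<chi>)"
    then show "\<psi> \<in> ?orb \<chi>" using h by (auto simp: act_act H0_mult_closed)
  next
    fix \<psi> assume "\<psi> \<in> ?orb \<chi>"
    then obtain k :: "'a mat" where k: "k \<in> H0" "\<psi> = act k \<chi>" by auto
    have "act (hinv h * k) (act h \<chi>) = act (h * hinv h * k) \<chi>"
      using h k by (simp add: act_act hinv H0_mult_closed H0_assoc[symmetric])
    also have "\<dots> = \<psi>" using h k H0_carrier[OF k(1)] by (simp add: hinv)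
    finally show "\<psi> \<in> ?orb (act h \<chi>)" using h k by (metis H0_mult_closed hinv(1) image_eqI)
  qed
  have "card (H0 :: 'a mat set) * card (?orb ` ?X) = card (\<Union>(?orb ` ?X))"
  proof (rule card_partition)
    show "finite (?orb ` ?X)" using finX by simp
    show "finite (\<Union>(?orb ` ?X))" unfolding un by (rule finX)
    show "card c = card (H0 :: 'a mat set)" if "c \<in> ?orb ` ?X" for c
      using that card_image[OF act_inj[OF two]] by auto
    show "c1 \<inter> c2 = {}" if c: "c1 \<in> ?orb ` ?X" "c2 \<in> ?orb ` ?X" "c1 \<noteq> c2" for c1 c2
    proof (rule ccontr)
      assume "c1 \<inter> c2 \<noteq> {}"
      then obtain \<psi> where "\<psi> \<in> c1" "\<psi> \<in> c2" by blast
      have "c = ?orb \<psi>" if c: "c \<in> ?orb ` ?X" "\<psi> \<in> c" for c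
      proof -
        obtain \<chi> where \<chi>: "\<chi> \<in> ?X" "c = ?orb \<chi>" using c(1) by blast
        obtain h where h: "\<psi> = act h \<chi>" "h \<in> H0" using c(2) unfolding \<chi>(2) by blast
        show ?thesis unfolding h(1) \<chi>(2) using orb_eq[OF h(2)] \<chi>(1) by simp
      qed
      then have "c1 = ?orb \<psi>" "c2 = ?orb \<psi>" using c(1,2) \<open>\<psi> \<in> c1\<close> \<open>\<psi> \<in> c2\<close> by blast+
      then show False using c(3) by simp
    qed
  qed
  moreover have "card (?S // rep_iso G0) = card (?f ` ?S)" by (rule card_rep_classes[OF iso])
  ultimately show ?thesis unfolding un cardX img by simp
qed

section \<open>The order of the rotation group\<close>

text \<open>Multiplication by \<open>y\<close> permutes the nonzero elements, so their product,
  itself nonzero, absorbs the factor \<open>y ^ (CARD('a) - 1)\<close>.\<close>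

lemma finite_field_power_card:
  fixes y :: "'a::{field,finite}"
  assumes "y \<noteq> 0"
  shows "y ^ (CARD('a) - 1) = 1"
proof -
  have "(\<Prod>x\<in>UNIV - {0}. x) = (\<Prod>x\<in>UNIV - {0}. y * x)"
    by (rule prod.reindex_bij_witness[of _ "\<lambda>x. y * x" "\<lambda>x. x / y"]) (use assms in auto)
  also have "\<dots> = y ^ (CARD('a) - 1) * (\<Prod>x\<in>UNIV - {0}. x)"
    by (simp add: prod.distrib)
  finally have "(y ^ (CARD('a) - 1) - 1) * (\<Prod>x\<in>UNIV - {0}. x) = 0" by (simp add: algebra_simps)
  moreover have "(\<Prod>x\<in>UNIV - {0::'a}. x) \<noteq> 0" by simp
  ultimately show ?thesis by simp
qed

lemma card_roots_of_one_le:
  assumes "n > 0"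
  shows "card {x::'a::field. x ^ n = 1} \<le> n"
proof -
  let ?p = "Polynomial.monom 1 n - 1 :: 'a poly"
  have deg: "degree ?p \<le> n" by (intro degree_diff_le) (simp_all add: degree_monom_le)
  have "Polynomial.coeff ?p n = 1" using assms by simp
  then have "?p \<noteq> 0" by (metis coeff_0 zero_neq_one)
  then have "card {x. poly ?p x = 0} \<le> degree ?p" by (rule card_poly_roots_bound)
  then show ?thesis using deg by (simp add: poly_monom)
qed

text \<open>The two cases are 2 roots and none. For \<open>q = 4k + 1\<close> a root is
  \<open>y ^ k\<close> with \<open>y ^ (2 * k) = - 1\<close>; for \<open>q = 4k + 3\<close> raising
  \<open>t\<^sup>2 = - 1\<close> to the odd power \<open>2 * k + 1\<close> would give
  \<open>1 = - 1\<close>.\<close>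

lemma card_sqrt_minus_one:
  assumes odd: "odd (CARD('a::{field,finite}))"
  shows "int (card {t::'a. t\<^sup>2 = - 1}) = 1 + eps (CARD('a))"
proof -
  have two: "(2::'a) \<noteq> 0" using odd by (rule two_neq_zero)
  have neg: "(1::'a) \<noteq> - 1"
  proof
    assume "(1::'a) = - 1"
    then have "(1::'a) + 1 = 0" by (metis add.right_inverse)
    then show False using two by simp
  qed
  show ?thesis
  proof (cases "CARD('a) mod 4 = 1")
    case True
    define k where "k = CARD('a) div 4"
    have q: "CARD('a) = 4 * k + 1" using True mult_div_mod_eq[of 4 "CARD('a)"] unfolding k_def by linarith
    \<comment> \<open>The residue alone would admit a field with one element, which
      \<open>0 \<noteq> 1\<close> rules out; a positive degree is needed for the root bound.\<close>
    have "k > 0"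
    proof (rule ccontr)
      assume "\<not> k > 0"
      then have "CARD('a) = 1" using q by simp
      then obtain x :: 'a where "UNIV = {x}" by (auto simp: card_1_singleton_iff)
      then have "(0::'a) = x" "(1::'a) = x" by blast+
      then show False using zero_neq_one by metis
    qed
    \<comment> \<open>There are \<open>4 * k\<close> nonzero elements but at most
      \<open>2 * k\<close> roots of \<open>x ^ (2 * k) = 1\<close>, so some \<open>y\<close> has
      another value there, and that value squares to 1.\<close>
    have "\<not> UNIV - {0} \<subseteq> {x::'a. x ^ (2 * k) = 1}"
    proof
      assume "UNIV - {0} \<subseteq> {x::'a. x ^ (2 * k) = 1}"
      then have "card (UNIV - {0::'a}) \<le> card {x::'a. x ^ (2 * k) = 1}" by (intro card_mono) auto
      also have "\<dots> \<le> 2 * k" using \<open>k > 0\<close> by (intro card_roots_of_one_le) simp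
      finally show False using q \<open>k > 0\<close> by simp
    qed
    then obtain y :: 'a where y: "y \<noteq> 0" "y ^ (2 * k) \<noteq> 1" by auto
    have "(y ^ (2 * k))\<^sup>2 = 1"
      using finite_field_power_card[OF y(1)] by (simp add: q power_mult[symmetric] mult.commute)
    then have "y ^ (2 * k) = - 1" using y(2) by (simp add: power2_eq_1_iff)
    then have i: "(y ^ k)\<^sup>2 = - 1" by (simp add: power_mult[symmetric] mult.commute)
    have "t\<^sup>2 = - 1 \<longleftrightarrow> t = y ^ k \<or> t = - (y ^ k)" for t
      using power2_eq_iff[of t "y ^ k"] unfolding i .
    then have "{t::'a. t\<^sup>2 = - 1} = {y ^ k, - (y ^ k)}" by blast
    moreover have "y ^ k \<noteq> - (y ^ k)"
    proof
      assume "y ^ k = - (y ^ k)"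
      then have "2 * y ^ k = 0" by (metis add.right_inverse mult_2)
      then show False using two y(1) by simp
    qed
    ultimately show ?thesis using True by (simp add: eps_def)
  next
    case False
    then have "CARD('a) mod 4 = 3" using odd by presburger
    define k where "k = CARD('a) div 4"
    have q: "CARD('a) = 4 * k + 3"
      using \<open>CARD('a) mod 4 = 3\<close> mult_div_mod_eq[of 4 "CARD('a)"] unfolding k_def by linarith
    have "t\<^sup>2 \<noteq> - 1" for t :: 'a
    proof
      assume t: "t\<^sup>2 = - 1"
      then have "t \<noteq> 0" by auto
      then have "t ^ (2 * (2 * k + 1)) = 1" using finite_field_power_card[of t] by (simp add: q)
      then have "(t\<^sup>2) ^ (2 * k + 1) = 1" by (simp only: power_mult)
      then show False using neg t by simp
    qed
    then show ?thesis using False by (simp add: eps_def)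
  qed
qed

text \<open>Stereographic projection from the point \<open>(-1, 0)\<close> of the circle.\<close>

lemma card_H0:
  assumes odd: "odd (CARD('a::{field,finite}))"
  shows "int (card (H0 :: 'a mat set)) = int (CARD('a)) - eps (CARD('a))"
proof -
  have two: "(2::'a) \<noteq> 0" using odd by (rule two_neq_zero)
  let ?C = "{(a::'a, b). a\<^sup>2 + b\<^sup>2 = 1}"
  let ?T = "{t::'a. t\<^sup>2 = - 1}"
  let ?M = "\<lambda>(a::'a, b). mat_of_rows_list 2 [[a, - b], [b, a]]"
  have img: "H0 = ?M ` ?C" by (auto simp: H0_def)
  have "inj_on ?M ?C"
  proof (rule inj_onI, clarify)
    fix a b c d :: 'a assume eq: "mat_of_rows_list 2 [[a, - b], [b, a]] = mat_of_rows_list 2 [[c, - d], [d, c]]"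
    have "mat_of_rows_list 2 [[x, - y], [y, x]] $$ (0, 0) = x" "mat_of_rows_list 2 [[x, - y], [y, x]] $$ (1, 0) = y"
      for x y :: 'a by (simp_all add: mat_of_rows_list_def)
    then show "a = c \<and> b = d" using eq by metis
  qed
  then have cH: "card (H0 :: 'a mat set) = card ?C" unfolding img by (rule card_image)
  \<comment> \<open>The parameter is the slope \<open>t\<close> of the line from
    \<open>(-1, 0)\<close> to a point of the circle. The omitted slopes have
    \<open>1 + t\<^sup>2 = 0\<close>, where the rational parametrization used as inverse has no
    value.\<close>
  have "bij_betw (\<lambda>(a, b). b / (1 + a)) (?C - {(- 1, 0)}) (UNIV - ?T)"
  proof (rule bij_betw_byWitness[of _ "\<lambda>t. ((1 - t\<^sup>2) / (1 + t\<^sup>2), 2 * t / (1 + t\<^sup>2))"])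
    have fwd: "1 + a \<noteq> 0 \<and> 1 + (b / (1 + a))\<^sup>2 = 2 / (1 + a) \<and> 1 - (b / (1 + a))\<^sup>2 = 2 * a / (1 + a)"
      if ab: "a\<^sup>2 + b\<^sup>2 = 1" "(a, b) \<noteq> (- 1, 0)" for a b :: 'a
    proof -
      have a: "1 + a \<noteq> 0"
      proof
        assume "1 + a = 0"
        then have "a = - 1" by (simp add: add_eq_0_iff)
        then have "b = 0" using ab(1) by simp
        then show False using ab(2) \<open>a = - 1\<close> by simp
      qed
      \<comment> \<open>On the circle this turns the squared slope into
        \<open>(1 - a) / (1 + a)\<close>, so \<open>1 + t\<^sup>2 = 2 / (1 + a)\<close> is
        nonzero.\<close>
      have b2: "b\<^sup>2 = (1 - a) * (1 + a)" using ab(1) by (simp add: algebra_simps power2_eq_square)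
      have "(b / (1 + a))\<^sup>2 = (1 - a) / (1 + a)"
        using a by (simp add: power_divide b2) (simp add: power2_eq_square)
      then show ?thesis using a by (simp add: field_simps)
    qed
    show "\<forall>x\<in>?C - {(- 1, 0)}. (\<lambda>t. ((1 - t\<^sup>2) / (1 + t\<^sup>2), 2 * t / (1 + t\<^sup>2))) ((\<lambda>(a, b). b / (1 + a)) x) = x"
    proof (rule ballI)
      fix x assume "x \<in> ?C - {(- 1, 0)}"
      then obtain a b where ab: "x = (a, b)" "a\<^sup>2 + b\<^sup>2 = 1" "(a, b) \<noteq> (- 1, 0)" by blast
      show "(\<lambda>t. ((1 - t\<^sup>2) / (1 + t\<^sup>2), 2 * t / (1 + t\<^sup>2))) ((\<lambda>(a, b). b / (1 + a)) x) = x"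
        using fwd[OF ab(2,3)] two by (simp add: ab(1))
    qed
    show "(\<lambda>(a, b). b / (1 + a)) ` (?C - {(- 1, 0)}) \<subseteq> UNIV - ?T"
    proof (rule image_subsetI)
      fix x assume "x \<in> ?C - {(- 1, 0)}"
      then obtain a b where ab: "x = (a, b)" "a\<^sup>2 + b\<^sup>2 = 1" "(a, b) \<noteq> (- 1, 0)" by blast
      have "(b / (1 + a))\<^sup>2 \<noteq> - 1" using fwd[OF ab(2,3)] two by auto
      then show "(\<lambda>(a, b). b / (1 + a)) x \<in> UNIV - ?T" by (simp add: ab(1))
    qed
    have bwd: "1 + t\<^sup>2 \<noteq> 0 \<and> 1 + (1 - t\<^sup>2) / (1 + t\<^sup>2) = 2 / (1 + t\<^sup>2)" if "t\<^sup>2 \<noteq> - 1" for t :: 'a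
    proof -
      have "1 + t\<^sup>2 \<noteq> 0" using that by (metis add.commute add_eq_0_iff)
      then show ?thesis by (simp add: field_simps)
    qed
    show "\<forall>t\<in>UNIV - ?T. (\<lambda>(a, b). b / (1 + a)) ((1 - t\<^sup>2) / (1 + t\<^sup>2), 2 * t / (1 + t\<^sup>2)) = t"
      using bwd two by simp
    show "(\<lambda>t. ((1 - t\<^sup>2) / (1 + t\<^sup>2), 2 * t / (1 + t\<^sup>2))) ` (UNIV - ?T) \<subseteq> ?C - {(- 1, 0)}"
    proof (rule image_subsetI)
      fix t assume "t \<in> UNIV - ?T"
      then have t: "1 + t\<^sup>2 \<noteq> 0" "1 + (1 - t\<^sup>2) / (1 + t\<^sup>2) = 2 / (1 + t\<^sup>2)" using bwd[of t] by auto
      have "((1 - t\<^sup>2) / (1 + t\<^sup>2))\<^sup>2 + (2 * t / (1 + t\<^sup>2))\<^sup>2 = ((1 - t\<^sup>2)\<^sup>2 + (2 * t)\<^sup>2) / (1 + t\<^sup>2)\<^sup>2"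
        by (simp add: power_divide add_divide_distrib)
      also have "(1 - t\<^sup>2)\<^sup>2 + (2 * t)\<^sup>2 = (1 + t\<^sup>2)\<^sup>2" by (simp add: power2_eq_square algebra_simps)
      finally have "((1 - t\<^sup>2) / (1 + t\<^sup>2))\<^sup>2 + (2 * t / (1 + t\<^sup>2))\<^sup>2 = 1" using t(1) by simp
      moreover have "(1 - t\<^sup>2) / (1 + t\<^sup>2) \<noteq> - 1"
      proof
        assume "(1 - t\<^sup>2) / (1 + t\<^sup>2) = - 1"
        then have "2 / (1 + t\<^sup>2) = 0" using t(2) by simp
        then show False using two t(1) by simp
      qed
      ultimately show "((1 - t\<^sup>2) / (1 + t\<^sup>2), 2 * t / (1 + t\<^sup>2)) \<in> ?C - {(- 1, 0)}" by simp
    qed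
  qed
  then have "card (?C - {(- 1, 0)}) = card (UNIV - ?T)" by (rule bij_betw_same_card)
  moreover have "card (?C - {(- 1, 0)}) = card ?C - 1" by (rule card_Diff_singleton) simp
  \<comment> \<open>Positivity is needed because subtraction on naturals truncates. The removed
    point then cancels the 1 in \<open>1 + eps\<close>, the number of omitted slopes.\<close>
  moreover have "card ?C > 0"
  proof -
    have "(- 1, 0) \<in> ?C" by simp
    moreover have "finite ?C" by simp
    ultimately show ?thesis unfolding card_gt_0_iff by blast
  qed
  moreover have "card (UNIV - ?T) = CARD('a) - card ?T" by (rule card_Diff_subset) auto
  moreover have "card ?T \<le> CARD('a)" by (rule card_mono) auto
  ultimately show ?thesis using card_sqrt_minus_one[OF odd] cH by linarith
qed

section \<open>Representations of type I\<close>

lemma mult_mat_1: "A \<in> carrier_mat 1 1 \<Longrightarrow> B \<in> carrier_mat 1 1 \<Longrightarrow> (A * B) $$ (0, 0) = A $$ (0, 0) * B $$ (0, 0)"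
  by (simp add: scalar_prod_def)

lemma mat_1_eqI:
  assumes "A \<in> carrier_mat 1 1" "B \<in> carrier_mat 1 1" "A $$ (0, 0) = B $$ (0, 0)"
  shows "A = B"
  using assms by (intro eq_matI) auto

lemma type_I_eq:
  assumes "type_I n \<rho>" "z \<in> N0" "h \<in> H0"
  shows "\<rho> (z, h) = \<rho> (0\<^sub>v 2, h)"
  using assms rep_factor[of n \<rho> z h] rep_carrier[of G0 n \<rho> "(0\<^sub>v 2, h)"]
  by (simp add: type_I_def N0_zero)

text \<open>The representation factors through the commutative group \<open>H0\<close>, which has a
  common eigenvector; the line spanned by it is invariant, hence everything.\<close>

lemma irr_type_I_degree:
  fixes \<rho> :: "'a::{field,finite} vec \<times> 'a mat \<Rightarrow> complex mat"
  assumes "(n, \<rho>) \<in> irr_type_I"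
  shows "n = 1"
proof -
  have irr: "irreducible_rep G0 n \<rho>" and I: "type_I n \<rho>" using assms by (auto simp: irr_type_I_def)
  have rep: "representation G0 n \<rho>" and n: "n \<noteq> 0" using irr by (auto simp: irreducible_rep_def)
  have fin: "finite (carrier (H0_grp :: 'a mat monoid))" by (simp add: finite_H0)
  \<comment> \<open>Any nonzero vector could be decomposed here; \<open>n \<noteq> 0\<close> makes
    \<open>unit_vec n 0\<close> one, so some component is nonzero.\<close>
  from comm_group.rep_char_decomposition[OF H0_grp_comm_group fin rep_H0[OF rep], of "unit_vec n 0"]
  obtain u where u: "\<forall>\<chi>\<in>chars (H0_grp :: 'a mat monoid). u \<chi> \<in> carrier_vec n \<and> (\<forall>h\<in>H0. \<rho> (0\<^sub>v 2, h) *\<^sub>v u \<chi> = \<chi> h \<cdot>\<^sub>v u \<chi>)"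
    "unit_vec n 0 = vsum n (chars H0_grp) u"
    by auto
  have "\<exists>\<chi>\<in>chars H0_grp. u \<chi> \<noteq> 0\<^sub>v n"
  proof (rule ccontr)
    assume "\<not> ?thesis"
    then have "vsum n (chars H0_grp) u = 0\<^sub>v n" by (auto simp: vsum_def)
    then show False using u(2) n unit_vec_nonzero[of 0 n] by simp
  qed
  then obtain \<chi> where \<chi>: "\<chi> \<in> chars H0_grp" "u \<chi> \<noteq> 0\<^sub>v n" by blast
  define w where "w = u \<chi>"
  have w: "w \<in> carrier_vec n" "w \<noteq> 0\<^sub>v n" "\<And>h. h \<in> H0 \<Longrightarrow> \<rho> (0\<^sub>v 2, h) *\<^sub>v w = \<chi> h \<cdot>\<^sub>v w"
    using \<chi> u(1) by (auto simp: w_def)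
  define W where "W = range (\<lambda>c. c \<cdot>\<^sub>v w)"
  have "vec_subspace n W"
    unfolding vec_subspace_iff
  proof (intro conjI ballI allI)
    show "W \<subseteq> carrier_vec n" using w(1) by (auto simp: W_def)
    have "0\<^sub>v n = 0 \<cdot>\<^sub>v w" using w(1) by auto
    then show "0\<^sub>v n \<in> W" unfolding W_def by (rule image_eqI) simp
    fix x assume "x \<in> W"
    then obtain c where x: "x = c \<cdot>\<^sub>v w" by (auto simp: W_def)
    show "d \<cdot>\<^sub>v x \<in> W" for d unfolding x W_def smult_smult_assoc by (rule imageI) simp
    fix y assume "y \<in> W"
    then obtain d where y: "y = d \<cdot>\<^sub>v w" by (auto simp: W_def)
    show "x + y \<in> W" unfolding x y W_def add_smult_distrib_vec[symmetric] by (rule imageI) simp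
  qed
  moreover have "\<rho> g *\<^sub>v x \<in> W" if g: "g \<in> carrier G0" and x: "x \<in> W" for g x
  proof -
    obtain z h where zh: "g = (z, h)" "z \<in> N0" "h \<in> H0" using g by (cases g) auto
    obtain c where x: "x = c \<cdot>\<^sub>v w" using x by (auto simp: W_def)
    have "\<rho> g *\<^sub>v x = c \<cdot>\<^sub>v (\<rho> g *\<^sub>v w)"
      unfolding x using rep_carrier[OF rep g] w(1) by (rule mult_mat_vec)
    also have "\<dots> = (c * \<chi> h) \<cdot>\<^sub>v w"
      using w(3)[OF zh(3)] type_I_eq[OF I zh(2,3)] by (simp add: zh(1) smult_smult_assoc)
    finally show ?thesis unfolding W_def by (rule image_eqI) simp
  qed
  moreover have "W \<noteq> {0\<^sub>v n}"
  proof
    assume "W = {0\<^sub>v n}"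
    moreover have "1 \<cdot>\<^sub>v w \<in> W" unfolding W_def by (rule imageI) simp
    ultimately show False using w(2) by simp
  qed
  ultimately have W: "W = carrier_vec n" using irr unfolding irreducible_rep_def by blast
  show "n = 1"
  proof (rule ccontr)
    assume "n \<noteq> 1"
    then have n2: "0 < n" "1 < n" using n by auto
    have "unit_vec n 0 \<in> W" "unit_vec n 1 \<in> W" unfolding W by auto
    then obtain c d where cd: "unit_vec n 0 = c \<cdot>\<^sub>v w" "unit_vec n 1 = d \<cdot>\<^sub>v w" by (auto simp: W_def)
    \<comment> \<open>The first equation makes \<open>c\<close> nonzero, the second then kills
      \<open>w $ 1\<close>, and the third needs it nonzero.\<close>
    have "unit_vec n 0 $ 0 = c * w $ 0" "unit_vec n 0 $ 1 = c * w $ 1" "unit_vec n 1 $ 1 = d * w $ 1"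
      using n2 w(1) by (simp_all only: cd) simp_all
    then show False using n2 by auto
  qed
qed

text \<open>The complete invariant in type I. The restriction to \<open>H0\<close> makes it an
  element of \<open>chars H0_grp\<close>.\<close>

definition H0_part :: "('a::field vec \<times> 'a mat \<Rightarrow> complex mat) \<Rightarrow> 'a mat \<Rightarrow> complex" where
  "H0_part \<rho> = restrict (\<lambda>h. \<rho> (0\<^sub>v 2, h) $$ (0, 0)) H0"

lemma H0_part_chars:
  fixes \<rho> :: "'a::field vec \<times> 'a mat \<Rightarrow> complex mat"
  assumes rep: "representation G0 1 \<rho>"
  shows "H0_part \<rho> \<in> chars H0_grp"
proof -
  note r = rep_H0[OF rep]
  have "restrict (\<lambda>h. \<rho> (0\<^sub>v 2, h) $$ (0, 0)) (carrier H0_grp) \<in> chars H0_grp"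
  proof (rule charsI)
    show "monoid (H0_grp :: 'a mat monoid)" using group_H0_grp by (rule group.is_monoid)
    show "\<rho> (0\<^sub>v 2, \<one>\<^bsub>H0_grp\<^esub>) $$ (0, 0) = 1" using rep_one[OF r group_H0_grp] by simp
    fix x y :: "'a mat" assume xy: "x \<in> carrier H0_grp" "y \<in> carrier H0_grp"
    show "\<rho> (0\<^sub>v 2, x \<otimes>\<^bsub>H0_grp\<^esub> y) $$ (0, 0) = \<rho> (0\<^sub>v 2, x) $$ (0, 0) * \<rho> (0\<^sub>v 2, y) $$ (0, 0)"
      using rep_mult[OF r xy] mult_mat_1[OF rep_carrier[OF r xy(1)] rep_carrier[OF r xy(2)]] by simp
  qed
  then show ?thesis by (simp add: H0_part_def)
qed

text \<open>Inflation along the projection onto \<open>H0\<close>, a right inverse of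
  \<open>H0_part\<close>. Irreducibility holds because any nonzero vector spans a space of dimension
  one.\<close>

lemma char_irr_type_I:
  fixes \<chi> :: "'a::field mat \<Rightarrow> complex"
  assumes \<chi>: "\<chi> \<in> chars H0_grp"
  shows "(1, \<lambda>(z, h). mat 1 1 (\<lambda>_. \<chi> h)) \<in> irr_type_I"
proof -
  let ?\<rho> = "\<lambda>(z :: 'a vec, h). mat 1 1 (\<lambda>_. \<chi> h)"
  have one: "\<chi> (1\<^sub>m 2) = 1" using chars_one[OF \<chi>] by simp
  have rep: "representation G0 1 ?\<rho>"
  proof (rule representationI)
    show "group (G0 :: ('a vec \<times> 'a mat) monoid)" by (rule group_G0)
    show "?\<rho> g \<in> carrier_mat 1 1" for g by (cases g) simp
    show "?\<rho> \<one>\<^bsub>G0\<^esub> = 1\<^sub>m 1" by (rule mat_1_eqI) (simp_all add: one)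
    fix g g' :: "'a vec \<times> 'a mat" assume "g \<in> carrier G0" "g' \<in> carrier G0"
    then obtain z h z' h' where g: "g = (z, h)" "g' = (z', h')" "h \<in> H0" "h' \<in> H0" by (cases g; cases g') auto
    show "?\<rho> (g \<otimes>\<^bsub>G0\<^esub> g') = ?\<rho> g * ?\<rho> g'"
    proof (rule mat_1_eqI)
      have c: "?\<rho> g \<in> carrier_mat 1 1" "?\<rho> g' \<in> carrier_mat 1 1" by (simp_all add: g)
      then show "?\<rho> g * ?\<rho> g' \<in> carrier_mat 1 1" by (rule mult_carrier_mat)
      show "?\<rho> (g \<otimes>\<^bsub>G0\<^esub> g') \<in> carrier_mat 1 1" by (simp add: g)
      show "?\<rho> (g \<otimes>\<^bsub>G0\<^esub> g') $$ (0, 0) = (?\<rho> g * ?\<rho> g') $$ (0, 0)"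
        unfolding mult_mat_1[OF c] using chars_mult[OF \<chi>, of h h'] g by simp
    qed
  qed
  have "irreducible_rep G0 1 ?\<rho>"
    unfolding irreducible_rep_def
  proof (intro conjI allI impI)
    fix W assume W: "vec_subspace 1 W"
    show "W = {0\<^sub>v 1} \<or> W = carrier_vec 1"
    proof (cases "W = {0\<^sub>v 1}")
      case False
      then obtain w where w: "w \<in> W" "w \<noteq> 0\<^sub>v 1" using W by (auto simp: vec_subspace_iff)
      have wc: "w \<in> carrier_vec 1" using w W by (auto simp: vec_subspace_iff)
      then have w0: "w $ 0 \<noteq> 0" using w(2) by (metis carrier_vecD eq_vecI index_zero_vec less_one)
      have "v \<in> W" if v: "v \<in> carrier_vec 1" for v
      proof -
        have "v = (v $ 0 / w $ 0) \<cdot>\<^sub>v w" using v wc w0 by (intro eq_vecI) auto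
        then show ?thesis using W w(1) by (metis vec_subspace_iff)
      qed
      then show ?thesis using W by (auto simp: vec_subspace_iff)
    qed simp
  qed (use rep in simp_all)
  moreover have "type_I 1 ?\<rho>"
    unfolding type_I_def using rep by (auto intro!: mat_1_eqI simp: one)
  ultimately show ?thesis by (simp add: irr_type_I_def)
qed

text \<open>In degree one an intertwiner is a nonzero scalar and cancels, so isomorphism means
  having the same character of \<open>H0\<close>, and every character of \<open>H0\<close>
  occurs.\<close>

lemma card_irr_type_I_classes:
  "card ((irr_type_I :: (nat \<times> ('a::{field,finite} vec \<times> 'a mat \<Rightarrow> complex mat)) set) // rep_iso G0)
    = card (H0 :: 'a mat set)"
proof -
  let ?S = "irr_type_I :: (nat \<times> ('a vec \<times> 'a mat \<Rightarrow> complex mat)) set"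
  let ?f = "\<lambda>(n :: nat, \<rho> :: 'a vec \<times> 'a mat \<Rightarrow> complex mat). H0_part \<rho>"
  have iso: "(x, y) \<in> rep_iso G0 \<longleftrightarrow> ?f x = ?f y" if xy: "x \<in> ?S" "y \<in> ?S" for x y
  proof -
    obtain n \<rho> m \<sigma> where eq: "x = (n, \<rho>)" "y = (m, \<sigma>)" by (cases x; cases y)
    have nm: "n = 1" "m = 1" using irr_type_I_degree xy eq by auto
    have I: "type_I 1 \<rho>" "type_I 1 \<sigma>" using xy unfolding eq nm by (auto simp: irr_type_I_def)
    then have rep: "representation G0 1 \<rho>" "representation G0 1 \<sigma>" by (auto simp: type_I_def)
    have "H0_part \<rho> = H0_part \<sigma>" if iso: "((1, \<rho>), (1, \<sigma>)) \<in> rep_iso G0"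
    proof -
      have "\<exists>P\<in>carrier (GL 1). \<forall>g\<in>carrier G0. P * \<rho> g = \<sigma> g * P"
        using iso unfolding rep_iso_def mem_Collect_eq prod.case by blast
      then obtain P where P: "P \<in> carrier (GL 1)" "\<forall>g\<in>carrier G0. P * \<rho> g = \<sigma> g * P" by blast
      obtain Q where Q: "P \<in> carrier_mat 1 1" "Q \<in> carrier_mat 1 1" "Q * P = 1\<^sub>m 1"
        using P(1) unfolding GL_iff by blast
      have "Q $$ (0, 0) * P $$ (0, 0) = 1" using mult_mat_1[OF Q(2,1)] Q(3) by simp
      then have p: "P $$ (0, 0) \<noteq> 0" by auto
      have "\<rho> (0\<^sub>v 2, h) $$ (0, 0) = \<sigma> (0\<^sub>v 2, h) $$ (0, 0)" if h: "h \<in> H0" for h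
      proof -
        have g: "(0\<^sub>v 2, h) \<in> carrier G0" using h by (simp add: N0_zero)
        have "(P * \<rho> (0\<^sub>v 2, h)) $$ (0, 0) = (\<sigma> (0\<^sub>v 2, h) * P) $$ (0, 0)"
          using P(2) g by simp
        then show ?thesis
          unfolding mult_mat_1[OF Q(1) rep_carrier[OF rep(1) g]] mult_mat_1[OF rep_carrier[OF rep(2) g] Q(1)]
          using p by (metis mult.commute mult_cancel_left)
      qed
      then show ?thesis by (auto simp: H0_part_def)
    qed
    moreover have "((1, \<rho>), (1, \<sigma>)) \<in> rep_iso G0" if part: "H0_part \<rho> = H0_part \<sigma>"
    proof -
      have "\<rho> g = \<sigma> g" if g: "g \<in> carrier G0" for g
      proof (rule mat_1_eqI)
        show "\<rho> g \<in> carrier_mat 1 1" "\<sigma> g \<in> carrier_mat 1 1" using rep g by (auto intro: rep_carrier)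
        obtain z h where zh: "g = (z, h)" "z \<in> N0" "h \<in> H0" using g by (cases g) auto
        show "\<rho> g $$ (0, 0) = \<sigma> g $$ (0, 0)"
          using fun_cong[OF part, of h] zh type_I_eq[OF I(1) zh(2,3)] type_I_eq[OF I(2) zh(2,3)]
          by (simp add: H0_part_def)
      qed
      then have "1\<^sub>m 1 * \<rho> g = \<sigma> g * 1\<^sub>m 1" if "g \<in> carrier G0" for g
        using that rep_carrier[OF rep(1) that] rep_carrier[OF rep(2) that] by simp
      moreover have "1\<^sub>m 1 \<in> carrier (GL 1)" by (auto simp: GL_iff)
      ultimately show ?thesis using rep unfolding rep_iso_def by blast
    qed
    ultimately show ?thesis unfolding eq nm prod.case by blast
  qed
  have "?f ` ?S = chars H0_grp"
  proof (intro equalityI subsetI)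
    fix \<chi> assume "\<chi> \<in> ?f ` ?S"
    then obtain n \<rho> where n\<rho>: "(n, \<rho>) \<in> ?S" "\<chi> = H0_part \<rho>" by auto
    then have "representation G0 1 \<rho>" using irr_type_I_degree[OF n\<rho>(1)] by (auto simp: irr_type_I_def type_I_def)
    then show "\<chi> \<in> chars H0_grp" using H0_part_chars n\<rho>(2) by simp
  next
    fix \<chi> :: "'a mat \<Rightarrow> complex" assume \<chi>: "\<chi> \<in> chars H0_grp"
    let ?\<rho> = "\<lambda>(z :: 'a vec, h). mat 1 1 (\<lambda>_. \<chi> h)"
    have "H0_part ?\<rho> = \<chi>"
      using chars_undefined[OF \<chi>] by (auto simp: H0_part_def restrict_def)
    then have "\<chi> = ?f (1, ?\<rho>)" by simp
    then show "\<chi> \<in> ?f ` ?S" using char_irr_type_I[OF \<chi>] by (rule image_eqI)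
  qed
  moreover have "card (?S // rep_iso G0) = card (?f ` ?S)" by (rule card_rep_classes[OF iso])
  ultimately show ?thesis
    using comm_group.card_chars[OF H0_grp_comm_group[where 'a = 'a]] finite_H0[where 'a = 'a] by simp
qed

theorem theorem5:
  fixes q :: nat
  assumes "q = CARD('a::{field,finite})" and "odd q"
  shows "int (card ((irr_type_I :: (nat \<times> ('a vec \<times> 'a mat \<Rightarrow> complex mat)) set) // rep_iso G0)) = int q - eps q
    \<and> (\<forall>(n, \<rho>) \<in> (irr_type_I :: (nat \<times> ('a vec \<times> 'a mat \<Rightarrow> complex mat)) set). n = 1)
    \<and> int (card ((irr_type_II :: (nat \<times> ('a vec \<times> 'a mat \<Rightarrow> complex mat)) set) // rep_iso G0)) = int q + eps q
    \<and> (\<forall>(n, \<rho>) \<in> (irr_type_II :: (nat \<times> ('a vec \<times> 'a mat \<Rightarrow> complex mat)) set). int n = int q - eps q)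
    \<and> quasirandom_on_N0 TYPE('a) (int q - eps q)"
proof (intro conjI)
  have odd: "odd (CARD('a))" using assms by simp
  have two: "(2::'a) \<noteq> 0" using odd by (rule two_neq_zero)
  have H: "int (card (H0 :: 'a mat set)) = int q - eps q" using card_H0[OF odd] assms(1) by simp
  show "int (card ((irr_type_I :: (nat \<times> ('a vec \<times> 'a mat \<Rightarrow> complex mat)) set) // rep_iso G0)) = int q - eps q"
    unfolding card_irr_type_I_classes by (rule H)
  show "\<forall>(n, \<rho>) \<in> (irr_type_I :: (nat \<times> ('a vec \<times> 'a mat \<Rightarrow> complex mat)) set). n = 1"
    using irr_type_I_degree by auto
  let ?c = "card ((irr_type_II :: (nat \<times> ('a vec \<times> 'a mat \<Rightarrow> complex mat)) set) // rep_iso G0)"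
  \<comment> \<open>Lets the truncated difference of naturals pass to the integers.\<close>
  have "q\<^sup>2 \<ge> 1" using assms(2) by (cases q) auto
  then have "int (card (H0 :: 'a mat set)) * int ?c = (int q)\<^sup>2 - 1"
    using arg_cong[OF card_irr_type_II_classes[OF two], of int] assms(1) by (simp add: of_nat_diff)
  \<comment> \<open>Uses that \<open>eps q\<close> squares to 1; the first factor is the positive
    number \<open>card H0\<close> and can then be cancelled.\<close>
  also have "\<dots> = (int q - eps q) * (int q + eps q)"
    by (simp add: eps_def algebra_simps power2_eq_square)
  finally show "int ?c = int q + eps q"
    using card_H0_pos[where 'a = 'a] unfolding H[symmetric] by simp
  show "\<forall>(n, \<rho>) \<in> (irr_type_II :: (nat \<times> ('a vec \<times> 'a mat \<Rightarrow> complex mat)) set). int n = int q - eps q"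
  proof clarify
    fix n and \<rho> :: "'a vec \<times> 'a mat \<Rightarrow> complex mat" assume n\<rho>: "(n, \<rho>) \<in> irr_type_II"
    obtain \<psi> where "\<psi> \<in> spectrum_N0 n \<rho>" using spectrum_irr_type_II[OF n\<rho>] .
    then show "int n = int q - eps q" using irr_type_II_iso_induced(1)[OF two n\<rho>] H by simp
  qed
  show "quasirandom_on_N0 TYPE('a) (int q - eps q)"
    unfolding quasirandom_on_N0_def H[symmetric] using type_II_degree_ge[OF two] by simp
qed

end
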